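(* For every fixed integer $k\ge 2$, as $n\to\infty$ (for sufficiently large $n\gg k$), \[ \frac{A(k,\lfloor (k-1)/2\rfloor)\,n^k}{k!\,(k+1)!}+O(n^{k-1})\le \log_2|\mathcal{B}(n,k)|\le \frac{n^k}{k!\,\log 2}+O(n^{k-1}\log n), \] where the implied constants may depend on $k$.
   Context: $\log$ is the natural logarithm. $A(m,d)$ is the Eulerian number counting permutations in $\mathfrak{S}_m$ with exactly $d$ descents. Let $\binom{[n]}{k}$ be the set of $k$-element subsets of $[n]=\{1,\dots,n\}$, each written in increasing order. For $X=[x_1<\dots<x_m]$ its packet is $P(X)=\{X\setminus\{x_i\}:1\le i\le m\}$. The lex order is the lexicographic order of increasing sequences and antilex is its reverse. A total order $\rho$ on $\binom{[n]}{k}$ is admissible if for every $X\in\binom{[n]}{k+1}$ the restriction $\rho|_{P(X)}$ is the lex or the antilex order on $P(X)$. $X,Y\in\binom{[n]}{k}$ commute if $P(X)\cap P(Y)=\varnothing$. Two admissible orders (written as sequences) are commutation equivalent if one is obtained from the other by a sequence of transpositions of adjacent commuting elements. The higher Bruhat order $\mathcal{B}(n,k)$ has as its underlying set the set of commutation equivalence classes of admissible orders on $\binom{[n]}{k}$. *)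

theory Defs
  imports Complex_Main "HOL-Library.Landau_Symbols" "HOL-Library.Ramsey"
    "HOL-Combinatorics.Permutations"
begin

definition eulerian :: "nat \<Rightarrow> nat \<Rightarrow> nat" where
  "eulerian m d =
     card {p. p permutes {1..m} \<and> card {i \<in> {1..<m}. p i > p (i + 1)} = d}"

definition packet :: "nat set \<Rightarrow> nat set set" where
  "packet X = {X - {x} | x. x \<in> X}"

definition lex_less :: "nat set \<Rightarrow> nat set \<Rightarrow> bool" where
  "lex_less X Y \<longleftrightarrow>
     (sorted_list_of_set X, sorted_list_of_set Y) \<in> lexord {(a, b). a < b}"

text \<open>A total order on the finite set \<open>nsets {1..n} k\<close> of all \<open>k\<close>-element subsets
  of \<open>{1..n}\<close> is represented by the list of these subsets in increasing order. The
  restriction of the order to a packet is then the sublist obtained by filtering.\<close>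

definition admissible_orders :: "nat \<Rightarrow> nat \<Rightarrow> nat set list set" where
  "admissible_orders n k =
     {\<rho>. distinct \<rho> \<and> set \<rho> = nsets {1..n} k \<and>
        (\<forall>X \<in> nsets {1..n} (k + 1).
           sorted_wrt lex_less (filter (\<lambda>Y. Y \<in> packet X) \<rho>) \<or>
           sorted_wrt (\<lambda>Y Z. lex_less Z Y) (filter (\<lambda>Y. Y \<in> packet X) \<rho>))}"

definition commute :: "nat set \<Rightarrow> nat set \<Rightarrow> bool" where
  "commute X Y \<longleftrightarrow> packet X \<inter> packet Y = {}"

definition comm_step :: "nat set list \<Rightarrow> nat set list \<Rightarrow> bool" where
  "comm_step \<rho> \<sigma> \<longleftrightarrow>
     (\<exists>us X Y vs. \<rho> = us @ [X, Y] @ vs \<and> \<sigma> = us @ [Y, X] @ vs \<and> commute X Y)"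

text \<open>Intermediate sequences need not be required to be admissible: two distinct
  members \<open>X\<close>, \<open>Y\<close> of a common packet share the element \<open>X \<inter> Y\<close> of their own packets
  and so never commute, whence \<open>comm_step\<close> preserves admissibility.\<close>

definition comm_equiv :: "nat \<Rightarrow> nat \<Rightarrow> (nat set list \<times> nat set list) set" where
  "comm_equiv n k =
     {(\<rho>, \<sigma>). \<rho> \<in> admissible_orders n k \<and> \<sigma> \<in> admissible_orders n k \<and>
        comm_step\<^sup>*\<^sup>* \<rho> \<sigma>}"

definition higher_bruhat :: "nat \<Rightarrow> nat \<Rightarrow> nat set list set set" where
  "higher_bruhat n k = admissible_orders n k // comm_equiv n k"

lemma comm_step_sym: "comm_step \<rho> \<sigma> \<Longrightarrow> comm_step \<sigma> \<rho>"
proof -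
  assume "comm_step \<rho> \<sigma>"
  then obtain us X Y vs where
    "\<rho> = us @ [X, Y] @ vs" "\<sigma> = us @ [Y, X] @ vs" "commute X Y"
    unfolding comm_step_def by (elim exE conjE)
  moreover from \<open>commute X Y\<close> have "commute Y X"
    by (simp only: commute_def Int_commute)
  ultimately show "comm_step \<sigma> \<rho>"
    unfolding comm_step_def by (intro exI conjI)
qed

lemma equiv_comm_equiv: "equiv (admissible_orders n k) (comm_equiv n k)"
proof (rule equivI)
  show "comm_equiv n k \<subseteq> admissible_orders n k \<times> admissible_orders n k"
    by (auto simp: comm_equiv_def)
  show "refl_on (admissible_orders n k) (comm_equiv n k)"
    by (auto simp: comm_equiv_def refl_on_def)
  have "symp comm_step\<^sup>*\<^sup>*"
    by (rule symp_rtranclp, rule sympI, rule comm_step_sym)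
  then show "sym (comm_equiv n k)"
    unfolding comm_equiv_def sym_def symp_def by blast
  show "trans (comm_equiv n k)"
    unfolding comm_equiv_def trans_def by (blast intro: rtranclp_trans)
qed

lemma finite_admissible_orders: "finite (admissible_orders n k)"
proof (rule finite_subset)
  show "admissible_orders n k \<subseteq> {\<rho>. set \<rho> = nsets {1..n} k \<and> distinct \<rho>}"
    by (auto simp: admissible_orders_def)
  have fin: "finite (nsets {1..n} k)"
    by (simp add: finite_imp_finite_nsets)
  show "finite {\<rho>. set \<rho> = nsets {1..n} k \<and> distinct \<rho>}"
    by (rule finite_subset[OF _ finite_subset_distinct[OF fin]]) auto
qed

lemma finite_higher_bruhat: "finite (higher_bruhat n k)"
  unfolding higher_bruhat_def
  by (rule finite_quotient[OF finite_admissible_orders]) (auto simp: comm_equiv_def)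

end

theory Submission
  imports Defs "HOL-Library.FuncSet" "HOL-Library.Nat_Bijection" "HOL-Library.Product_Lexorder"
    "HOL-Combinatorics.Multiset_Permutations"
begin

text \<open>
  Upper bound. The class of an admissible order is determined by which packets are in lex
  order. For a \<open>(k - 2)\<close>-set \<open>R\<close> the order restricted to the sets \<open>R \<union> {i, j}\<close> with
  \<open>max R < i < j\<close> is a pseudoline arrangement on \<open>m = n - max R\<close> lines, and every packet
  is seen by the \<open>R\<close> obtained by dropping its three largest elements. Such an arrangement is
  determined by recording, for each line, only whether its successive crossings are with larger
  or smaller lines; there are at most \<open>\<Prod>a<m. (m - 1) choose a \<le> exp (m choose 2)\<close> such codes.
  The exponents add up to \<open>n choose k\<close>, so \<open>|B(n,k)| \<le> exp (n choose k)\<close>.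

  Lower bound. Fix \<open>c\<close>, and order the \<open>k\<close>-sets so that a packet \<open>P(X)\<close> is lex if
  \<open>\<Sum>X < c\<close> and antilex if \<open>\<Sum>X > c\<close>. This is a sorting by a quadratic potential, which
  is constant exactly on the packets with \<open>\<Sum>X = c\<close>; these are pairwise disjoint, so each can be
  oriented freely, and \<open>|B(n,k)|\<close> is at least \<open>2\<close> to the number of \<open>(k + 1)\<close>-subsets of
  \<open>[n]\<close> with sum \<open>c\<close>. For \<open>c = n (d + 1)\<close> these sets are counted by Eulerian numbers: the cyclic
  gaps modulo \<open>n\<close> of a sequence of \<open>k\<close> distinct elements of \<open>[n - 1]\<close> with \<open>d\<close> descents
  add up to \<open>n (d + 1)\<close>.
\<close>

section \<open>Commutation classes\<close>

text \<open>An element that does not occur gets position \<open>length xs\<close>, beyond the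
  position of every member.\<close>

definition pos :: "'a list \<Rightarrow> 'a \<Rightarrow> nat" where
  "pos xs x = length (takeWhile (\<lambda>y. y \<noteq> x) xs)"

lemma pos_Nil [simp]: "pos [] x = 0"
  by (simp add: pos_def)

lemma pos_Cons: "pos (a # xs) x = (if a = x then 0 else Suc (pos xs x))"
  by (simp add: pos_def)

lemma pos_append: "pos (xs @ ys) x = (if x \<in> set xs then pos xs x else length xs + pos ys x)"
  by (induction xs) (auto simp: pos_Cons)

lemma pos_inj: "x \<in> set xs \<Longrightarrow> pos xs x = pos xs y \<Longrightarrow> x = y"
  by (induction xs) (auto simp: pos_Cons split: if_splits)

lemma pos_less_length: "x \<in> set xs \<Longrightarrow> pos xs x < length xs"
  by (induction xs) (auto simp: pos_Cons)

text \<open>This turns the condition on filtered sublists in \<open>admissible_orders\<close> into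
  comparisons of positions.\<close>

lemma sorted_wrt_filter_iff_pos:
  assumes "distinct xs"
  shows "sorted_wrt P (filter Q xs) \<longleftrightarrow>
    (\<forall>x\<in>set xs. \<forall>y\<in>set xs. Q x \<longrightarrow> Q y \<longrightarrow> pos xs x < pos xs y \<longrightarrow> P x y)"
  using assms
proof (induction xs)
  case (Cons a xs)
  then have *: "pos (a # xs) x = Suc (pos xs x)" if "x \<in> set xs" for x
    using that by (auto simp: pos_Cons)
  have "pos (a # xs) a = 0"
    by (simp add: pos_Cons)
  then show ?case
    using Cons by (simp add: * Ball_def) blast
qed simp

lemma comm_step_Cons: "comm_step xs ys \<Longrightarrow> comm_step (a # xs) (a # ys)"
  unfolding comm_step_def by (metis append_Cons)

lemma comm_steps_Cons: "comm_step\<^sup>*\<^sup>* xs ys \<Longrightarrow> comm_step\<^sup>*\<^sup>* (a # xs) (a # ys)"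
  by (induction rule: rtranclp_induct) (auto intro: comm_step_Cons rtranclp.rtrancl_into_rtrancl)

lemma comm_steps_move_front:
  assumes "\<And>u. u \<in> set us \<Longrightarrow> commute u a"
  shows "comm_step\<^sup>*\<^sup>* (us @ a # vs) (a # us @ vs)"
  using assms
proof (induction us)
  case (Cons u us)
  have "comm_step\<^sup>*\<^sup>* (u # us @ a # vs) (u # a # us @ vs)"
    using Cons by (intro comm_steps_Cons) auto
  also have "comm_step (u # a # us @ vs) (a # u # us @ vs)"
    unfolding comm_step_def using Cons.prems[of u] by (intro exI[of _ "[]"]) auto
  finally show ?case by simp
qed simp

text \<open>The head \<open>a\<close> of \<open>xs\<close> can be moved to the front of
  \<open>ys\<close>: an element that precedes \<open>a\<close> in \<open>ys\<close> but does not
  commute with it would come after \<open>a\<close> in \<open>xs\<close>, hence also in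
  \<open>ys\<close>. The tails are then treated by induction.\<close>

lemma comm_steps_if_same_order:
  assumes "distinct xs" "distinct ys" "set xs = set ys"
    and "\<And>x y. \<lbrakk>x \<in> set xs; y \<in> set xs; x \<noteq> y; \<not> commute x y; pos xs x < pos xs y\<rbrakk>
      \<Longrightarrow> pos ys x < pos ys y"
  shows "comm_step\<^sup>*\<^sup>* ys xs"
  using assms
proof (induction xs arbitrary: ys)
  case (Cons a xs)
  then obtain us vs where ys: "ys = us @ a # vs"
    by (metis list.set_intros(1) split_list)
  have comm: "commute u a" if "u \<in> set us" for u
  proof (rule ccontr)
    assume "\<not> commute u a"
    then have "\<not> commute a u"
      by (simp add: commute_def Int_commute)
    moreover have "u \<noteq> a" "u \<in> set (a # xs)"
      using Cons.prems that ys by auto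
    ultimately have "pos ys a < pos ys u"
      using Cons.prems(4)[of a u] by (auto simp: pos_Cons)
    moreover have "pos us u < length us"
      using that by (rule pos_less_length)
    ultimately show False
      using that Cons.prems ys by (auto simp: pos_append)
  qed
  have "comm_step\<^sup>*\<^sup>* (us @ vs) xs"
  proof (rule Cons.IH)
    show "distinct xs" "distinct (us @ vs)"
      using Cons.prems ys by auto
    have "insert a (set xs) = insert a (set (us @ vs))" "a \<notin> set xs" "a \<notin> set (us @ vs)"
      using Cons.prems ys by auto
    then show "set xs = set (us @ vs)"
      using insert_ident by metis
    fix x y
    assume xy: "x \<in> set xs" "y \<in> set xs" "x \<noteq> y" "\<not> commute x y" "pos xs x < pos xs y"
    then have "pos ys x < pos ys y"
      using Cons.prems by (intro Cons.prems(4)) (auto simp: pos_Cons)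
    then show "pos (us @ vs) x < pos (us @ vs) y"
      using xy Cons.prems(1) pos_less_length[of x us]
      by (auto simp: ys pos_append pos_Cons split: if_splits)
  qed
  then show ?case
    using comm_steps_move_front[of us a vs] comm comm_steps_Cons ys
    by (meson rtranclp_trans)
qed simp

text \<open>Exchanging neighbours affects only the relative order of those two, and they commute, so
  they are not the pair \<open>x\<close>, \<open>y\<close>.\<close>

lemma pos_swap:
  assumes "\<not> commute x y" "commute X Y"
  shows "pos (us @ X # Y # vs) x < pos (us @ X # Y # vs) y \<longleftrightarrow>
    pos (us @ Y # X # vs) x < pos (us @ Y # X # vs) y"
proof (induction us)
  case Nil
  have "commute Y X"
    using assms by (simp add: commute_def Int_commute)
  then have "\<not> (x = X \<and> y = Y)" "\<not> (x = Y \<and> y = X)"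
    using assms by blast+
  then show ?case
    by (auto simp: pos_Cons)
qed (simp add: pos_Cons)

lemma comm_steps_order:
  assumes "comm_step\<^sup>*\<^sup>* xs ys" "\<not> commute x y"
  shows "pos xs x < pos xs y \<longleftrightarrow> pos ys x < pos ys y"
  using assms(1)
proof (induction rule: rtranclp_induct)
  case (step ys zs)
  then obtain us X Y vs where "ys = us @ X # Y # vs" "zs = us @ Y # X # vs" "commute X Y"
    unfolding comm_step_def by auto
  then show ?case
    using step.IH pos_swap[OF assms(2)] by simp
qed simp

section \<open>Orientation of packets\<close>

text \<open>The two lists agree on the elements below \<open>x\<close>; then the first continues
  with \<open>x\<close>, the second with an element \<open>c\<close> above \<open>x\<close>, which
  exists because \<open>y\<close> is available.\<close>

lemma lex_less_packet:
  assumes "finite X" "x \<in> X" "y \<in> X" "x < y"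
  shows "lex_less (X - {y}) (X - {x})"
proof -
  define A where "A = {z \<in> X. z < x}"
  define B where "B = {z \<in> X. z > x} - {y}"
  define C where "C = {z \<in> X. z > x}"
  have fin: "finite A" "finite B" "finite C"
    using assms(1) by (auto simp: A_def B_def C_def)
  have 1: "sorted_list_of_set (X - {y}) = sorted_list_of_set A @ x # sorted_list_of_set B"
    using fin assms
    by (intro sorted_distinct_set_unique)
       (fastforce simp: sorted_append A_def B_def)+
  have 2: "sorted_list_of_set (X - {x}) = sorted_list_of_set A @ sorted_list_of_set C"
    using fin assms
    by (intro sorted_distinct_set_unique)
       (fastforce simp: sorted_append A_def C_def)+
  have "sorted_list_of_set C \<noteq> []"
    using fin assms by (auto simp: C_def)
  then obtain c cs where 3: "sorted_list_of_set C = c # cs"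
    by (cases "sorted_list_of_set C") auto
  then have "c \<in> C"
    using fin by (metis list.set_intros(1) set_sorted_list_of_set)
  then show ?thesis
    unfolding lex_less_def 1 2 3 by (auto simp: C_def lexord_append_leftI)
qed

lemma lex_less_asym: "lex_less X Y \<Longrightarrow> \<not> lex_less Y X"
  unfolding lex_less_def
  by (rule lexord_asymmetric) auto

text \<open>Deleting a larger element leaves a lexicographically smaller set, so lex order runs
  through a packet by decreasing deleted element and antilex order by increasing one.\<close>

definition lexed :: "nat set list \<Rightarrow> nat set \<Rightarrow> bool" where
  "lexed \<rho> X \<longleftrightarrow> (\<forall>x\<in>X. \<forall>y\<in>X. x < y \<longrightarrow> pos \<rho> (X - {y}) < pos \<rho> (X - {x}))"

definition antilexed :: "nat set list \<Rightarrow> nat set \<Rightarrow> bool" where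
  "antilexed \<rho> X \<longleftrightarrow> (\<forall>x\<in>X. \<forall>y\<in>X. x < y \<longrightarrow> pos \<rho> (X - {x}) < pos \<rho> (X - {y}))"

lemma lexed_iff:
  assumes "distinct \<rho>" "packet X \<subseteq> set \<rho>" "finite X"
  shows "sorted_wrt lex_less (filter (\<lambda>Y. Y \<in> packet X) \<rho>) \<longleftrightarrow> lexed \<rho> X"
    and "sorted_wrt (\<lambda>Y Z. lex_less Z Y) (filter (\<lambda>Y. Y \<in> packet X) \<rho>) \<longleftrightarrow> antilexed \<rho> X"
proof -
  have lex: "lex_less (X - {y}) (X - {x}) \<longleftrightarrow> x < y" if "x \<in> X" "y \<in> X" "x \<noteq> y" for x y
    using lex_less_packet lex_less_asym assms(3) that by (metis linorder_neqE_nat)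
  have mem: "X - {x} \<in> set \<rho>" if "x \<in> X" for x
    using assms(2) that by (auto simp: packet_def)
  have inj: "x = y" if "x \<in> X" "y \<in> X" "pos \<rho> (X - {x}) = pos \<rho> (X - {y})" for x y
  proof -
    have "X - {x} = X - {y}"
      by (rule pos_inj[OF mem[OF that(1)] that(3)])
    moreover have "x \<notin> X - {x}"
      by simp
    ultimately have "x \<notin> X - {y}"
      by simp
    then show ?thesis
      using that(1) by simp
  qed
  have all: "(\<forall>U\<in>set \<rho>. \<forall>V\<in>set \<rho>. U \<in> packet X \<longrightarrow> V \<in> packet X \<longrightarrow> P U V) \<longleftrightarrow>
     (\<forall>x\<in>X. \<forall>y\<in>X. P (X - {x}) (X - {y}))" for P
  proof -
    have "packet X = (\<lambda>x. X - {x}) ` X"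
      by (auto simp: packet_def)
    moreover have "(\<forall>U\<in>set \<rho>. \<forall>V\<in>set \<rho>. U \<in> packet X \<longrightarrow> V \<in> packet X \<longrightarrow> P U V) \<longleftrightarrow>
        (\<forall>U\<in>packet X. \<forall>V\<in>packet X. P U V)"
      using assms(2) by (meson subsetD)
    ultimately show ?thesis
      by simp
  qed
  \<comment> \<open>Contraposition in each direction; injectivity of \<open>f\<close> on
    \<open>X\<close> excludes ties.\<close>
  have *: "(\<forall>x\<in>X. \<forall>y\<in>X. f x < f y \<longrightarrow> y < x) \<longleftrightarrow> (\<forall>x\<in>X. \<forall>y\<in>X. x < y \<longrightarrow> f y < f x)"
    if "inj_on f X" for f :: "nat \<Rightarrow> nat"
    using that by (metis inj_onD linorder_neqE_nat order.asym)
  have **: "(\<forall>x\<in>X. \<forall>y\<in>X. f x < f y \<longrightarrow> x < y) \<longleftrightarrow> (\<forall>x\<in>X. \<forall>y\<in>X. x < y \<longrightarrow> f x < f y)"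
    if "inj_on f X" for f :: "nat \<Rightarrow> nat"
    using that by (metis inj_onD linorder_neqE_nat order.asym)
  have inj: "inj_on (\<lambda>x. pos \<rho> (X - {x})) X"
    using inj by (auto simp: inj_on_def)
  have lex': "(pos \<rho> (X - {x}) < pos \<rho> (X - {y}) \<longrightarrow> lex_less (X - {x}) (X - {y})) \<longleftrightarrow>
      (pos \<rho> (X - {x}) < pos \<rho> (X - {y}) \<longrightarrow> y < x)"
    "(pos \<rho> (X - {x}) < pos \<rho> (X - {y}) \<longrightarrow> lex_less (X - {y}) (X - {x})) \<longleftrightarrow>
      (pos \<rho> (X - {x}) < pos \<rho> (X - {y}) \<longrightarrow> x < y)" if "x \<in> X" "y \<in> X" for x y
    using lex[of x y] lex[of y x] that by (cases "x = y"; simp)+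
  show "sorted_wrt lex_less (filter (\<lambda>Y. Y \<in> packet X) \<rho>) \<longleftrightarrow> lexed \<rho> X"
    unfolding sorted_wrt_filter_iff_pos[OF assms(1)] all lexed_def *[OF inj, symmetric]
    by (intro ball_cong refl lex')
  show "sorted_wrt (\<lambda>Y Z. lex_less Z Y) (filter (\<lambda>Y. Y \<in> packet X) \<rho>) \<longleftrightarrow> antilexed \<rho> X"
    unfolding sorted_wrt_filter_iff_pos[OF assms(1)] all antilexed_def **[OF inj, symmetric]
    by (intro ball_cong refl lex')
qed

lemma packet_subset_nsets:
  assumes "X \<in> nsets A (k + 1)"
  shows "packet X \<subseteq> nsets A k"
  using assms by (auto simp: packet_def nsets_def)

lemma admissible_iff:
  "\<rho> \<in> admissible_orders n k \<longleftrightarrow> distinct \<rho> \<and> set \<rho> = nsets {1..n} k \<and>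
     (\<forall>X \<in> nsets {1..n} (k + 1). lexed \<rho> X \<or> antilexed \<rho> X)"
proof -
  have "(sorted_wrt lex_less (filter (\<lambda>Y. Y \<in> packet X) \<rho>) \<or>
        sorted_wrt (\<lambda>Y Z. lex_less Z Y) (filter (\<lambda>Y. Y \<in> packet X) \<rho>)) \<longleftrightarrow>
      lexed \<rho> X \<or> antilexed \<rho> X"
    if "distinct \<rho>" "set \<rho> = nsets {1..n} k" "X \<in> nsets {1..n} (k + 1)" for X
  proof -
    have "finite X"
      using that(3) by (simp add: nsets_def)
    then show ?thesis
      using lexed_iff[of \<rho> X] packet_subset_nsets[OF that(3)] that(1,2) by simp
  qed
  then show ?thesis
    unfolding admissible_orders_def by blast
qed

text \<open>If \<open>A - {y} = B - {x}\<close> is a common packet member, then \<open>A\<close> and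
  \<open>B\<close> both lie in the packet of \<open>insert x A\<close>. So the relative order of two
  non-commuting sets is always governed by the orientation of a packet.\<close>

lemma not_commute_iff:
  assumes "A \<noteq> B"
  shows "\<not> commute A B \<longleftrightarrow> (\<exists>X x y. x \<in> X \<and> y \<in> X \<and> x \<noteq> y \<and> A = X - {x} \<and> B = X - {y})"
proof
  assume "\<not> commute A B"
  then obtain Z where "Z \<in> packet A" "Z \<in> packet B"
    unfolding commute_def by blast
  then obtain x y where xy: "x \<in> B" "y \<in> A" "A - {y} = B - {x}"
    unfolding packet_def by auto
  then have "x \<noteq> y"
    using assms by (metis insert_Diff)
  moreover from this have "x \<notin> A"
    using xy by blast
  moreover have "insert x (A - {y}) = B"
    using xy by (simp add: insert_absorb)
  ultimately have "A = insert x A - {x}" "B = insert x A - {y}"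
    by (simp_all add: insert_Diff_if)
  then show "\<exists>X x y. x \<in> X \<and> y \<in> X \<and> x \<noteq> y \<and> A = X - {x} \<and> B = X - {y}"
    using xy(2) \<open>x \<noteq> y\<close> by (intro exI[of _ "insert x A"] exI[of _ x] exI[of _ y]) simp
next
  assume "\<exists>X x y. x \<in> X \<and> y \<in> X \<and> x \<noteq> y \<and> A = X - {x} \<and> B = X - {y}"
  then obtain X x y where xy: "x \<in> X" "y \<in> X" "x \<noteq> y" "A = X - {x}" "B = X - {y}"
    by blast
  have "A - {y} \<in> packet A" "B - {x} \<in> packet B"
    unfolding packet_def using xy by auto
  moreover have "A - {y} = B - {x}"
    using xy by auto
  ultimately show "\<not> commute A B"
    unfolding commute_def by auto
qed

section \<open>Pseudoline arrangements\<close>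

text \<open>With \<open>p i j\<close> read as the time at which lines \<open>i\<close> and
  \<open>j\<close> cross, this counts the crossings on line \<open>i\<close> before the one with
  \<open>j\<close>.\<close>

definition pair_rank :: "nat set \<Rightarrow> (nat \<Rightarrow> nat \<Rightarrow> nat) \<Rightarrow> nat \<Rightarrow> nat \<Rightarrow> nat" where
  "pair_rank L p i j = card {l \<in> L - {i}. p i l < p i j}"

lemma pair_rank_strict_mono:
  assumes "finite L" "j \<in> L - {i}" "p i j < p i l"
  shows "pair_rank L p i j < pair_rank L p i l"
  unfolding pair_rank_def using assms by (intro psubset_card_mono) auto

lemma pair_rank_less:
  assumes "finite L" "i \<in> L" "j \<in> L - {i}"
  shows "pair_rank L p i j < card L - 1"
proof -
  have "pair_rank L p i j < card (L - {i})"
    unfolding pair_rank_def using assms by (intro psubset_card_mono) auto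
  then show ?thesis
    using assms by simp
qed

text \<open>Only crossings on a common line need different times. Three lines cross pairwise in the
  order \<open>ij\<close>, \<open>il\<close>, \<open>jl\<close> or in its reverse; these are the two
  orientations of the triple.\<close>

locale pseudolines =
  fixes L :: "nat set" and p :: "nat \<Rightarrow> nat \<Rightarrow> nat"
  assumes fin: "finite L"
    and sym: "p i j = p j i"
    and inj: "\<lbrakk>i \<in> L; j \<in> L; l \<in> L; i \<noteq> j; i \<noteq> l; p i j = p i l\<rbrakk> \<Longrightarrow> j = l"
    and triple: "\<lbrakk>i \<in> L; j \<in> L; l \<in> L; i < j; j < l\<rbrakk> \<Longrightarrow>
      p i j < p i l \<and> p i l < p j l \<or> p j l < p i l \<and> p i l < p i j"
begin

lemma rank_inj:
  assumes "i \<in> L" "j \<in> L" "l \<in> L" "i \<noteq> j" "i \<noteq> l" "pair_rank L p i j = pair_rank L p i l"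
  shows "j = l"
proof (rule inj[OF assms(1-5)], rule ccontr)
  assume "p i j \<noteq> p i l"
  then show False
    using pair_rank_strict_mono[OF fin, of j i p l] pair_rank_strict_mono[OF fin, of l i p j] assms
    by (cases "p i j < p i l") auto
qed

end

text \<open>The code of line \<open>i\<close> is the set of ranks at which it meets a larger line;
  which larger line it meets is not recorded.\<close>

locale two_pseudolines = p: pseudolines L p + q: pseudolines L q for L p q +
  assumes code: "i \<in> L \<Longrightarrow> pair_rank L p i ` {j \<in> L. i < j} = pair_rank L q i ` {j \<in> L. i < j}"
begin

text \<open>Ranks on a line are injective, so a rank belongs to the common code exactly if the line
  met there is larger than \<open>i\<close>, in \<open>p\<close> as well as in
  \<open>q\<close>.\<close>

lemma same_side:
  assumes "i \<in> L" "j \<in> L" "l \<in> L" "i \<noteq> j" "i \<noteq> l" "pair_rank L p i j = pair_rank L q i l"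
  shows "i < j \<longleftrightarrow> i < l"
proof
  assume "i < j"
  then have "pair_rank L q i l \<in> pair_rank L q i ` {j \<in> L. i < j}"
    unfolding code[OF assms(1), symmetric] assms(6)[symmetric] using assms(2) by blast
  then obtain l' where "l' \<in> L" "i < l'" "pair_rank L q i l = pair_rank L q i l'"
    by blast
  then show "i < l"
    using q.rank_inj[of i l l'] assms(1,3,5) by blast
next
  assume "i < l"
  then have "pair_rank L p i j \<in> pair_rank L p i ` {j \<in> L. i < j}"
    unfolding code[OF assms(1)] assms(6) using assms(3) by blast
  then obtain j' where "j' \<in> L" "i < j'" "pair_rank L p i j = pair_rank L p i j'"
    by blast
  then show "i < j"
    using p.rank_inj[of i j j'] assms(1,2,4) by blast
qed

text \<open>Sweep along \<open>p\<close>: the crossings with \<open>p\<close>-time below \<open>t\<close> form a down-set for \<open>q\<close>.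
  The next \<open>p\<close>-crossing \<open>{i, j}\<close> must also be available in \<open>q\<close>, because the next letters of the
  codes of \<open>i\<close> and \<open>j\<close> prevent either line from crossing a third one first.\<close>

lemma down_set:
  assumes "i \<in> L" "j \<in> L" "l \<in> L" "i \<noteq> j" "i \<noteq> l" "p i l < t" "q i j < q i l"
  shows "p i j < t"
  using assms
proof (induction t arbitrary: i j l)
  case (Suc t)
  \<comment> \<open>Here \<open>{a, b}\<close> is crossed at time \<open>t\<close> in
    \<open>p\<close>, and \<open>{x, y}\<close> is a \<open>q\<close>-earliest crossing of
    \<open>a\<close> or \<open>b\<close> with a third line that precedes \<open>{a, b}\<close> in
    \<open>q\<close> but follows it in \<open>p\<close>.\<close>
  have next_crossing: False
    if ab: "a \<in> L" "b \<in> L" "a < b" "p a b = t"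
      and e: "x \<in> {a, b}" "y \<in> L - {a, b}" "p x y > t" "q x y < q a b"
      and min: "\<And>x' y'. \<lbrakk>x' \<in> {a, b}; y' \<in> L - {a, b}; q x' y' < q x y\<rbrakk> \<Longrightarrow> p x' y' \<le> t"
    for a b x y
  proof -
    define z where "z = (if x = a then b else a)"
    have z: "z \<in> L" "x \<noteq> z" "p x z = t" "q x z = q a b" "x \<in> L" "y \<in> L" "x \<noteq> y" "y \<noteq> z" "{x, z} = {a, b}"
      using ab e p.sym[of b a] q.sym[of b a] by (auto simp: z_def)
    have less: "p x' y' < t" if "x' \<in> {a, b}" "y' \<in> L - {a, b}" "q x' y' < q x y" for x' y'
    proof -
      have "p x' y' \<noteq> t"
        using that(1,2) ab p.inj[of a y' b] p.inj[of b y' a] p.sym[of b a] by auto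
      then show ?thesis
        using min[OF that] by simp
    qed
    \<comment> \<open>The crossings on \<open>x\<close> before \<open>z\<close> in \<open>p\<close>
      are those before \<open>y\<close> in \<open>q\<close>. Hence \<open>z\<close> and
      \<open>y\<close> have the same rank on \<open>x\<close>, and the common code puts them on the
      same side of \<open>x\<close>.\<close>
    have "p x u < p x z \<longleftrightarrow> q x u < q x y" if "u \<in> L - {x}" for u
    proof (cases "u = z \<or> u = y")
      case True
      then show ?thesis
        using e(3,4) z(3,4) by auto
    next
      case False
      then have "u \<in> L - {a, b}"
        unfolding z(9)[symmetric] using that by blast
      then have "q x u < q x y \<Longrightarrow> p x u < t"
        using less e(1) by blast
      moreover have "q x u < q x y" if "p x u < t"
      proof (rule ccontr)
        assume "\<not> q x u < q x y"
        moreover have "q x u \<noteq> q x y"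
          using q.inj[of x u y] z(5-7) False \<open>u \<in> L - {x}\<close> by blast
        ultimately have "q x y < q x u"
          by simp
        then have "p x y < t"
          using Suc.IH[of x y u] z(5-7) \<open>u \<in> L - {x}\<close> that by blast
        then show False
          using e(3) by simp
      qed
      ultimately show ?thesis
        using z(3) by blast
    qed
    then have "pair_rank L p x z = pair_rank L q x y"
      unfolding pair_rank_def by (intro arg_cong[where f = card] Collect_cong) blast
    then have side: "x < z \<longleftrightarrow> x < y"
      using same_side[of x z y] z(1,2,5-7) by blast
    have down: "p u v < t \<longrightarrow> p u w < t" if "q u w < q u v" "u \<in> L" "v \<in> L" "w \<in> L" "u \<noteq> v" "u \<noteq> w" for u v w
      using Suc.IH that by blast
    have zy: "q z y < q x y \<longrightarrow> p z y < t"
      using less[of z y] z(9) e(2) by blast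
    have xyz: "p y x = p x y" "p z x = p x z" "p y z = p z y" "q y x = q x y" "q z x = q x z" "q y z = q z y"
      by (rule p.sym q.sym)+
    have yz: "q z y < q x y" if "p z y < t"
    proof (rule ccontr)
      assume "\<not> q z y < q x y"
      moreover have "q z y \<noteq> q x y"
        using q.inj[of y z x] z(1,2,5-8) xyz by metis
      ultimately show False
        using down[of y x z] z(1,2,5-8) e(3) xyz that by simp
    qed
    have *: "q x y < q x z" "p x z < p x y"
      using e(3,4) z(3,4) by linarith+
    \<comment> \<open>In every case \<open>x\<close> is extreme among the three lines. Since
      \<open>p\<close> and \<open>q\<close> orient the triple oppositely, \<open>{y, z}\<close>
      comes before \<open>{x, z}\<close> in \<open>p\<close> iff it comes after
      \<open>{x, y}\<close> in \<open>q\<close>, contrary to \<open>zy\<close> and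
      \<open>yz\<close>.\<close>
    consider "x < z" "z < y" | "x < y" "y < z" | "z < x" "y < z" | "y < x" "z < y"
      using side z by linarith
    then show False
    proof cases
      case 1
      then show False
        using p.triple[of x z y] q.triple[of x z y] z(1,3,5,6) zy xyz * yz by linarith
    next
      case 2
      then show False
        using p.triple[of x y z] q.triple[of x y z] z(1,3,5,6) zy xyz * yz by linarith
    next
      case 3
      then show False
        using p.triple[of y z x] q.triple[of y z x] z(1,3,5,6) zy xyz * yz by linarith
    next
      case 4
      then show False
        using p.triple[of z y x] q.triple[of z y x] z(1,3,5,6) zy xyz * yz by linarith
    qed
  qed
  show ?case
  proof (cases "p i l < t")
    case True
    then show ?thesis
      using Suc by (metis less_Suc_eq)
  next
    case False
    then have t: "p i l = t"
      using Suc.prems by simp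
    show ?thesis
    proof (rule ccontr)
      assume "\<not> p i j < Suc t"
      define a where "a = min i l"
      define b where "b = max i l"
      have ab: "a \<in> L" "b \<in> L" "a < b" "p a b = t" "{a, b} = {i, l}" "q a b = q i l"
        using Suc.prems t p.sym[of i l] q.sym[of i l] by (auto simp: a_def b_def min_def max_def)
      define E where "E = (\<lambda>(x, y). x \<in> {a, b} \<and> y \<in> L - {a, b} \<and> p x y > t \<and> q x y < q a b)"
      have "j \<noteq> l"
        using Suc.prems by auto
      then have "E (i, j)"
        using Suc.prems ab \<open>\<not> p i j < Suc t\<close> by (auto simp: E_def)
      then obtain e where e: "E e" "\<And>e'. E e' \<Longrightarrow> (case e of (x, y) \<Rightarrow> q x y) \<le> (case e' of (x, y) \<Rightarrow> q x y)"
        using ex_has_least_nat[of E "(i, j)" "\<lambda>(x, y). q x y"] by blast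
      obtain x y where xy: "e = (x, y)"
        by (cases e)
      show False
      proof (rule next_crossing[OF ab(1-4)])
        show "x \<in> {a, b}" "y \<in> L - {a, b}" "p x y > t" "q x y < q a b"
          using e(1) by (auto simp: xy E_def)
        show "p x' y' \<le> t" if "x' \<in> {a, b}" "y' \<in> L - {a, b}" "q x' y' < q x y" for x' y'
        proof (rule ccontr)
          assume "\<not> p x' y' \<le> t"
          moreover have "q x' y' < q a b"
            using that(3) e(1) by (auto simp: xy E_def)
          ultimately have "E (x', y')"
            using that by (auto simp: E_def)
          then show False
            using e(2)[of "(x', y')"] that(3) by (simp add: xy)
        qed
      qed
    qed
  qed
qed simp

lemma same_order:
  assumes "i \<in> L" "j \<in> L" "l \<in> L" "i \<noteq> j" "i \<noteq> l"
  shows "p i j < p i l \<longleftrightarrow> q i j < q i l"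
proof -
  \<comment> \<open>The bound \<open>Suc (p i l)\<close> yields \<open>p i j \<le> p i l\<close>,
    and equality is excluded by injectivity along line \<open>i\<close>.\<close>
  have 1: "p i j < p i l" if "q i j < q i l" "j \<in> L" "l \<in> L" "i \<noteq> j" "i \<noteq> l" for j l
    using down_set[of i j l "Suc (p i l)"] p.inj[of i j l] that assms(1) by fastforce
  show ?thesis
  proof (cases "j = l")
    case False
    then have "p i j \<noteq> p i l" "q i j \<noteq> q i l"
      using p.inj q.inj assms by blast+
    then show ?thesis
      using 1[of j l] 1[of l j] assms by linarith
  qed simp
qed

end

section \<open>Estimates for binomial coefficients\<close>

lemma power_div_fact_le_exp:
  assumes "x \<ge> (0::real)"
  shows "x ^ m / fact m \<le> exp x"
proof -
  have "(\<Sum>i\<in>{m}. x ^ i /\<^sub>R fact i) \<le> (\<Sum>i. x ^ i /\<^sub>R fact i)"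
    using assms by (intro sum_le_suminf summable_exp_generic) auto
  then show ?thesis
    by (simp add: exp_def field_simps)
qed

text \<open>Passing from \<open>m\<close> to \<open>m + 1\<close> multiplies the product by
  \<open>(m + 1) ^ (m + 1) / (m + 1)!\<close>, a single term of the series of
  \<open>exp (m + 1)\<close>; the exponents add up to \<open>1 + ... + m\<close>.\<close>

lemma prod_binomial_le_exp: "(\<Prod>a\<le>m. real (m choose a)) \<le> exp (real (Suc m choose 2))"
proof (induction m)
  case (Suc m)
  have 1: "real (Suc m choose a) = real (m choose a) * (real (Suc m) / real (Suc m - a))"
    if "a \<in> {..m}" for a
  proof -
    have "real ((Suc m - a) * (Suc m choose a)) = real (Suc m * (m choose a))"
      by (metis binomial_absorb_comp diff_Suc_1)
    then show ?thesis
      using that by (simp add: field_simps)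
  qed
  have "(\<Prod>a\<le>m. real (Suc m - a)) = fact (Suc m)"
    unfolding fact_prod_rev by (simp add: atLeast0_lessThan_Suc_eq_insert_0 atLeast0LessThan lessThan_Suc_atMost)
  then have "(\<Prod>a\<le>Suc m. real (Suc m choose a)) =
      (\<Prod>a\<le>m. real (m choose a)) * (real (Suc m) ^ Suc m / fact (Suc m))"
    using 1 by (simp add: prod.distrib prod_dividef del: of_nat_Suc fact_Suc)
  also have "\<dots> \<le> exp (real (Suc m choose 2)) * exp (real (Suc m))"
    using Suc power_div_fact_le_exp[of "real (Suc m)" "Suc m"]
    by (intro mult_mono) (auto intro: prod_nonneg)
  also have "\<dots> = exp (real (Suc (Suc m) choose 2))"
    by (simp add: exp_add[symmetric] numeral_2_eq_2)
  finally show ?case .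
qed simp

lemma prod_binomial_interval_le_exp:
  "(\<Prod>i\<in>{r<..n}. real ((n - r - 1) choose (n - i))) \<le> exp (real ((n - r) choose 2))"
proof (cases "r < n")
  case True
  have "(\<Prod>i\<in>{r<..n}. real ((n - r - 1) choose (n - i))) =
      (\<Prod>a\<le>n - r - 1. real ((n - r - 1) choose a))"
    using True by (intro prod.reindex_bij_witness[of _ "\<lambda>a. n - a" "\<lambda>i. n - i"]) auto
  also have "\<dots> \<le> exp (real ((n - r) choose 2))"
    using prod_binomial_le_exp[of "n - r - 1"] True by (simp add: Suc_diff_Suc)
  finally show ?thesis .
qed simp

lemma card_nsets:
  assumes "finite A"
  shows "card (nsets A k) = card A choose k"
proof -
  have "nsets A k = {B. B \<subseteq> A \<and> card B = k}"
    using assms by (auto simp: nsets_def intro: finite_subset)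
  then show ?thesis
    using n_subsets[OF assms] by simp
qed

text \<open>Adjoining to \<open>R\<close> two elements above its maximum gives a
  \<open>k\<close>-set, from which \<open>R\<close> is recovered by dropping the two largest
  elements; the sum counts the pairs of this injection.\<close>

lemma sum_choose_2_le:
  assumes "k \<ge> 2"
  shows "(\<Sum>R\<in>nsets {1..n} (k - 2). (n - Max (insert 0 R)) choose 2) \<le> n choose k"
proof -
  define m where "m = (\<lambda>R::nat set. Max (insert 0 R))"
  define S where "S = Sigma (nsets {1..n} (k - 2)) (\<lambda>R. nsets {m R<..n} 2)"
  have less: "x < y" if "(R, P) \<in> S" "x \<in> R" "y \<in> P" for R P x y
  proof -
    have "x \<le> m R" "m R < y"
      using that by (auto simp: S_def m_def nsets_def)
    then show ?thesis
      by simp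
  qed
  have sub: "R \<subseteq> R'" if "(R, P) \<in> S" "(R', P') \<in> S" "R \<union> P = R' \<union> P'" for R P R' P'
  proof (rule ccontr)
    assume "\<not> R \<subseteq> R'"
    then obtain x where x: "x \<in> R" "x \<notin> R'"
      by blast
    then have "x \<in> P'"
      using that(3) by blast
    have "y \<in> R" if "y \<in> R'" for y
    proof -
      have "y < x"
        using less[OF \<open>(R', P') \<in> S\<close> that \<open>x \<in> P'\<close>] .
      then have "y \<notin> P"
        using less[OF \<open>(R, P) \<in> S\<close> x(1), of y] by auto
      then show ?thesis
        using that \<open>R \<union> P = R' \<union> P'\<close> by blast
    qed
    then have "R' \<subset> R"
      using x by blast
    moreover have "finite R" "card R = card R'"
      using that by (auto simp: S_def nsets_def)
    ultimately show False
      using psubset_card_mono by (metis order.irrefl)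
  qed
  have disj: "R \<inter> P = {}" if "(R, P) \<in> S" for R P
    using less[OF that] by fastforce
  have "inj_on (\<lambda>(R, P). R \<union> P) S"
  proof (rule inj_onI, clarify)
    fix R P R' P'
    assume *: "(R, P) \<in> S" "(R', P') \<in> S" "R \<union> P = R' \<union> P'"
    then have "R = R'"
      using sub[of R P R' P'] sub[of R' P' R P] by auto
    then show "R = R' \<and> P = P'"
      using *(3) disj[OF *(1)] disj[OF *(2)] by blast
  qed
  moreover have "(\<lambda>(R, P). R \<union> P) ` S \<subseteq> nsets {1..n} k"
  proof clarify
    fix R P assume *: "(R, P) \<in> S"
    then have "card (R \<union> P) = k"
      using disj[OF *] assms by (auto simp: S_def nsets_def card_Un_disjoint)
    then show "R \<union> P \<in> nsets {1..n} k"
      using * by (auto simp: S_def nsets_def)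
  qed
  ultimately have "card S \<le> card (nsets {1..n} k)"
    by (intro card_inj_on_le finite_imp_finite_nsets) simp_all
  moreover have "card S = (\<Sum>R\<in>nsets {1..n} (k - 2). (n - m R) choose 2)"
    unfolding S_def by (subst card_SigmaI) (auto simp: finite_imp_finite_nsets card_nsets)
  ultimately show ?thesis
    by (simp add: m_def card_nsets)
qed

section \<open>Upper bound\<close>

text \<open>For \<open>k = 2\<close> the only \<open>R\<close> is empty; its value 0 makes all of
  \<open>{1..n}\<close> the set of lines.\<close>

abbreviation max0 :: "nat set \<Rightarrow> nat" where
  "max0 R \<equiv> Max (insert 0 R)"

definition contraction :: "nat set list \<Rightarrow> nat set \<Rightarrow> nat \<Rightarrow> nat \<Rightarrow> nat" where
  "contraction \<rho> R i j = pos \<rho> (R \<union> {i, j})"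

definition code_index :: "nat \<Rightarrow> nat \<Rightarrow> (nat set \<times> nat) set" where
  "code_index n k = Sigma (nsets {1..n} (k - 2)) (\<lambda>R. {max0 R<..n})"

definition crossing_code :: "nat \<Rightarrow> nat \<Rightarrow> nat set list \<Rightarrow> nat set \<times> nat \<Rightarrow> nat set" where
  "crossing_code n k \<rho> = (\<lambda>(R, i)\<in>code_index n k.
     pair_rank {max0 R<..n} (contraction \<rho> R) i ` {j \<in> {max0 R<..n}. i < j})"

text \<open>An admissible order makes the whole packet lex or antilex, so comparing any two of its
  members decides which.\<close>

lemma lexed_or_antilexed_cases:
  assumes "\<rho> \<in> admissible_orders n k" "X \<in> nsets {1..n} (k + 1)" "x \<in> X" "y \<in> X" "x < y"
  shows "lexed \<rho> X \<longleftrightarrow> pos \<rho> (X - {y}) < pos \<rho> (X - {x})"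
    and "antilexed \<rho> X \<longleftrightarrow> pos \<rho> (X - {x}) < pos \<rho> (X - {y})"
  using assms unfolding admissible_iff lexed_def antilexed_def by (meson order.asym)+

lemma triple_union_mem_nsets:
  assumes "k \<ge> 2" "R \<in> nsets {1..n} (k - 2)" "max0 R < i" "i < j" "j < l" "l \<le> n"
  shows "R \<union> {i, j, l} \<in> nsets {1..n} (k + 1)"
    and "R \<union> {i, j, l} - {i} = R \<union> {j, l}"
    and "R \<union> {i, j, l} - {j} = R \<union> {i, l}"
    and "R \<union> {i, j, l} - {l} = R \<union> {i, j}"
proof -
  have R: "finite R" "R \<subseteq> {1..n}" "card R = k - 2"
    using assms(2) by (auto simp: nsets_def)
  then have *: "x < i" if "x \<in> R" for x
    using assms(3) that by simp
  then have nin: "i \<notin> R" "j \<notin> R" "l \<notin> R"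
    using assms(4,5) by fastforce+
  then have "card (R \<union> {i, j, l}) = k + 1"
    using R assms by simp
  then show "R \<union> {i, j, l} \<in> nsets {1..n} (k + 1)"
    using R assms by (auto simp: nsets_def)
  show "R \<union> {i, j, l} - {i} = R \<union> {j, l}"
    and "R \<union> {i, j, l} - {j} = R \<union> {i, l}"
    and "R \<union> {i, j, l} - {l} = R \<union> {i, j}"
    using nin assms by auto
qed

text \<open>The triple condition is the orientation of the packet of
  \<open>R \<union> {i, j, l}\<close>, restricted to its members without \<open>l\<close>,
  \<open>j\<close> and \<open>i\<close>.\<close>

lemma pseudolines_contraction:
  assumes "\<rho> \<in> admissible_orders n k" "k \<ge> 2" "R \<in> nsets {1..n} (k - 2)"
  shows "pseudolines {max0 R<..n} (contraction \<rho> R)"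
proof
  have R: "finite R" "R \<subseteq> {1..n}" "card R = k - 2"
    using assms(3) by (auto simp: nsets_def)
  then have nin: "i \<notin> R" if "i \<in> {max0 R<..n}" for i
    using that by auto
  show "finite {max0 R<..n}"
    by simp
  show "contraction \<rho> R i j = contraction \<rho> R j i" for i j
    by (simp add: contraction_def insert_commute)
  show "j = l" if "i \<in> {max0 R<..n}" "j \<in> {max0 R<..n}" "l \<in> {max0 R<..n}" "i \<noteq> j" "i \<noteq> l"
    "contraction \<rho> R i j = contraction \<rho> R i l" for i j l
  proof -
    have "card (R \<union> {i, j}) = k"
      using nin[OF that(1)] nin[OF that(2)] that(4) R assms(2) by simp
    then have "R \<union> {i, j} \<in> set \<rho>"
      using R that(1,2) assms(1) by (auto simp: admissible_iff nsets_def)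
    then have "R \<union> {i, j} = R \<union> {i, l}"
      using pos_inj that(6) unfolding contraction_def by metis
    then have "j \<in> R \<union> {i, l}"
      by blast
    then show ?thesis
      using nin[OF that(2)] that(4) by simp
  qed
  show "contraction \<rho> R i j < contraction \<rho> R i l \<and> contraction \<rho> R i l < contraction \<rho> R j l \<or>
      contraction \<rho> R j l < contraction \<rho> R i l \<and> contraction \<rho> R i l < contraction \<rho> R i j"
    if "i \<in> {max0 R<..n}" "j \<in> {max0 R<..n}" "l \<in> {max0 R<..n}" "i < j" "j < l" for i j l
  proof -
    have "max0 R < i" "l \<le> n"
      using that by auto
    note X = triple_union_mem_nsets[OF assms(2,3) this(1) that(4,5) this(2)]
    have "lexed \<rho> (R \<union> {i, j, l}) \<or> antilexed \<rho> (R \<union> {i, j, l})"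
      using assms(1) X(1) by (simp add: admissible_iff)
    then show ?thesis
    proof
      assume "lexed \<rho> (R \<union> {i, j, l})"
      then have "pos \<rho> (R \<union> {i, j, l} - {l}) < pos \<rho> (R \<union> {i, j, l} - {j})"
        "pos \<rho> (R \<union> {i, j, l} - {j}) < pos \<rho> (R \<union> {i, j, l} - {i})"
        unfolding lexed_def using that(4,5) by blast+
      then show ?thesis
        unfolding X contraction_def by blast
    next
      assume "antilexed \<rho> (R \<union> {i, j, l})"
      then have "pos \<rho> (R \<union> {i, j, l} - {j}) < pos \<rho> (R \<union> {i, j, l} - {l})"
        "pos \<rho> (R \<union> {i, j, l} - {i}) < pos \<rho> (R \<union> {i, j, l} - {j})"
        unfolding antilexed_def using that(4,5) by blast+
      then show ?thesis
        unfolding X contraction_def by blast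
    qed
  qed
qed

lemma nsets_top_three:
  assumes "X \<in> nsets {1..n} (k + 1)" "k \<ge> 2"
  obtains R i j l where "R \<in> nsets {1..n} (k - 2)" "max0 R < i" "i < j" "j < l" "l \<le> n"
    "X = R \<union> {i, j, l}"
proof -
  have top: "\<exists>Y x. Y \<in> nsets {1..n} m \<and> max0 Y < x \<and> x \<le> n \<and> Z = insert x Y"
    if "Z \<in> nsets {1..n} (Suc m)" for Z m
  proof (intro exI conjI)
    have Z: "finite Z" "Z \<subseteq> {1..n}" "card Z = Suc m" "Z \<noteq> {}"
      using that by (auto simp: nsets_def)
    then have M: "Max Z \<in> Z"
      by (intro Max_in)
    show "Z - {Max Z} \<in> nsets {1..n} m"
      using Z M by (auto simp: nsets_def)
    show "Max Z \<le> n"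
      using M Z(2) by auto
    show "Z = insert (Max Z) (Z - {Max Z})"
      using M by blast
    have "z < Max Z" if "z \<in> Z - {Max Z}" for z
      using that Z(1) by (simp add: order.not_eq_order_implies_strict)
    moreover have "0 < Max Z"
      using M Z(2) by force
    ultimately show "max0 (Z - {Max Z}) < Max Z"
      using Z(1) by simp
  qed
  obtain m where m: "k = m + 2"
    using assms(2) by (metis add.commute le_Suc_ex)
  obtain A l where A: "A \<in> nsets {1..n} (Suc (Suc m))" "max0 A < l" "l \<le> n" "X = insert l A"
    using top[of X "Suc (Suc m)"] assms(1) m by auto
  obtain B j where B: "B \<in> nsets {1..n} (Suc m)" "max0 B < j" "j \<le> n" "A = insert j B"
    using top[OF A(1)] by blast
  obtain R i where R: "R \<in> nsets {1..n} m" "max0 R < i" "i \<le> n" "B = insert i R"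
    using top[OF B(1)] by blast
  have "finite A" "finite B"
    using A(1) B(1) by (auto simp: nsets_def)
  then have "j < l" "i < j"
    using A(2,4) B(2,4) R(4) by auto
  moreover have "X = R \<union> {i, j, l}"
    using A(4) B(4) R(4) by blast
  ultimately show ?thesis
    using that[of R i j l] R A(3) m by simp
qed

text \<open>With \<open>i < j < l\<close> the three largest elements of \<open>X\<close> and
  \<open>R\<close> the rest, the orientation of \<open>X\<close> is the order in which line
  \<open>i\<close> meets \<open>j\<close> and \<open>l\<close>; \<open>same_order\<close> recovers
  this from the code.\<close>

lemma code_determines_orientation:
  assumes "\<rho> \<in> admissible_orders n k" "\<sigma> \<in> admissible_orders n k" "k \<ge> 2"
    and eq: "crossing_code n k \<rho> = crossing_code n k \<sigma>" and X: "X \<in> nsets {1..n} (k + 1)"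
  shows "lexed \<rho> X \<longleftrightarrow> lexed \<sigma> X"
proof -
  obtain R i j l where R: "R \<in> nsets {1..n} (k - 2)" "max0 R < i" "i < j" "j < l" "l \<le> n"
    "X = R \<union> {i, j, l}"
    using nsets_top_three[OF X assms(3)] .
  interpret p: pseudolines "{max0 R<..n}" "contraction \<rho> R"
    by (rule pseudolines_contraction) fact+
  interpret q: pseudolines "{max0 R<..n}" "contraction \<sigma> R"
    by (rule pseudolines_contraction) fact+
  interpret two_pseudolines "{max0 R<..n}" "contraction \<rho> R" "contraction \<sigma> R"
  proof
    fix a assume "a \<in> {max0 R<..n}"
    then have "(R, a) \<in> code_index n k"
      using R(1) by (simp add: code_index_def)
    then show "pair_rank {max0 R<..n} (contraction \<rho> R) a ` {j \<in> {max0 R<..n}. a < j} =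
        pair_rank {max0 R<..n} (contraction \<sigma> R) a ` {j \<in> {max0 R<..n}. a < j}"
      using fun_cong[OF eq, of "(R, a)"] by (simp add: crossing_code_def)
  qed
  note T = triple_union_mem_nsets[OF assms(3) R(1-5)]
  have "lexed \<tau> X \<longleftrightarrow> contraction \<tau> R i j < contraction \<tau> R i l"
    if "\<tau> \<in> admissible_orders n k" for \<tau>
    using lexed_or_antilexed_cases(1)[OF that T(1), of j l] R(4) T(3,4)
    unfolding R(6) contraction_def by simp
  then show ?thesis
    using same_order[of i j l] R(2-5) assms(1,2) by simp
qed

text \<open>Equal codes give equal orientations of all packets, hence the same order on every
  non-commuting pair.\<close>

lemma comm_equiv_if_same_code:
  assumes "\<rho> \<in> admissible_orders n k" "\<sigma> \<in> admissible_orders n k" "k \<ge> 2"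
    and eq: "crossing_code n k \<rho> = crossing_code n k \<sigma>"
  shows "(\<rho>, \<sigma>) \<in> comm_equiv n k"
proof -
  have "comm_step\<^sup>*\<^sup>* \<rho> \<sigma>"
  proof (rule comm_steps_if_same_order)
    show "distinct \<sigma>" "distinct \<rho>" "set \<sigma> = set \<rho>"
      using assms by (auto simp: admissible_iff)
    fix A B
    assume AB: "A \<in> set \<sigma>" "B \<in> set \<sigma>" "A \<noteq> B" "\<not> commute A B" "pos \<sigma> A < pos \<sigma> B"
    then obtain X x y where X: "x \<in> X" "y \<in> X" "x \<noteq> y" "A = X - {x}" "B = X - {y}"
      using not_commute_iff by metis
    have "A \<in> nsets {1..n} k" "B \<in> nsets {1..n} k"
      using AB(1,2) assms(2) by (auto simp: admissible_iff)
    moreover have "X = insert x A" "x \<in> B" "x \<notin> A"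
      using X by auto
    ultimately have "X \<in> nsets {1..n} (k + 1)"
      by (auto simp: nsets_def)
    note cs = lexed_or_antilexed_cases[OF _ this]
    have lexed: "lexed \<rho> X \<longleftrightarrow> lexed \<sigma> X"
      by (rule code_determines_orientation) fact+
    have or: "lexed \<rho> X \<or> antilexed \<rho> X"
      using assms(1) \<open>X \<in> _\<close> by (simp add: admissible_iff)
    show "pos \<rho> A < pos \<rho> B"
    proof (cases "x < y")
      case True
      then have "\<not> lexed \<sigma> X"
        using cs(1)[OF assms(2) X(1,2)] AB(5) unfolding X(4,5) by simp
      then show ?thesis
        using or lexed cs(2)[OF assms(1) X(1,2) True] unfolding X(4,5) by simp
    next
      case False
      then have "y < x"
        using X(3) by simp
      then show ?thesis
        using cs(1)[OF assms(2) X(2,1)] cs(1)[OF assms(1) X(2,1)] lexed AB(5) unfolding X(4,5) by simp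
    qed
  qed
  then show ?thesis
    using assms by (simp add: comm_equiv_def)
qed

section \<open>Counting the codes\<close>

text \<open>Line \<open>i\<close> meets \<open>n - max0 R - 1\<close> others, of which
  \<open>n - i\<close> are larger, so its code is an \<open>(n - i)\<close>-subset of the possible
  ranks.\<close>

lemma code_in_PiE:
  assumes "\<rho> \<in> admissible_orders n k" "k \<ge> 2"
  shows "crossing_code n k \<rho> \<in>
    (\<Pi>\<^sub>E (R, i)\<in>code_index n k. nsets {..<n - max0 R - 1} (n - i))"
proof (rule PiE_I)
  fix e assume e: "e \<in> code_index n k"
  obtain R i where Ri: "e = (R, i)" "R \<in> nsets {1..n} (k - 2)" "i \<in> {max0 R<..n}"
    using e unfolding code_index_def by blast
  define L where "L = {max0 R<..n}"
  interpret pseudolines L "contraction \<rho> R"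
    unfolding L_def by (rule pseudolines_contraction) fact+
  let ?f = "pair_rank L (contraction \<rho> R) i" and ?J = "{j \<in> L. i < j}"
  have "?f j < n - max0 R - 1" if "j \<in> ?J" for j
    using pair_rank_less[OF fin, of i j] that Ri(3) by (simp add: L_def)
  moreover have "card (?f ` ?J) = n - i"
  proof -
    have "inj_on ?f ?J"
      using rank_inj[of i] Ri(3) unfolding L_def by (intro inj_onI) auto
    moreover have "?J = {i<..n}"
      using Ri(3) by (auto simp: L_def)
    ultimately show ?thesis
      by (simp add: card_image)
  qed
  ultimately have "?f ` ?J \<in> nsets {..<n - max0 R - 1} (n - i)"
    using fin by (auto simp: nsets_def)
  then show "crossing_code n k \<rho> e \<in> (case e of (R, i) \<Rightarrow> nsets {..<n - max0 R - 1} (n - i))"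
    using e by (simp add: crossing_code_def Ri(1) L_def)
qed (auto simp: crossing_code_def)

lemma card_higher_bruhat_le:
  assumes "k \<ge> 2"
  shows "real (card (higher_bruhat n k)) \<le> exp (real (n choose k))"
proof -
  define F where "F = (\<Pi>\<^sub>E (R, i)\<in>code_index n k. nsets {..<n - max0 R - 1} (n - i))"
  define rep where "rep = (\<lambda>C. SOME \<rho>. \<rho> \<in> (C :: nat set list set))"
  have fin: "finite (code_index n k)"
    unfolding code_index_def by (auto simp: finite_imp_finite_nsets)
  have rep: "rep C \<in> C" "C \<subseteq> admissible_orders n k" if "C \<in> higher_bruhat n k" for C
    using that equiv_comm_equiv[of n k] in_quotient_imp_non_empty in_quotient_imp_subset
    unfolding higher_bruhat_def rep_def some_in_eq by blast+
  have "inj_on (\<lambda>C. crossing_code n k (rep C)) (higher_bruhat n k)"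
  proof (rule inj_onI)
    fix C D
    assume *: "C \<in> higher_bruhat n k" "D \<in> higher_bruhat n k" "crossing_code n k (rep C) = crossing_code n k (rep D)"
    then have "(rep C, rep D) \<in> comm_equiv n k"
      using rep[OF *(1)] rep[OF *(2)] assms by (intro comm_equiv_if_same_code) auto
    then show "C = D"
      using quotient_eqI[OF equiv_comm_equiv] rep(1) * unfolding higher_bruhat_def by metis
  qed
  moreover have "(\<lambda>C. crossing_code n k (rep C)) ` higher_bruhat n k \<subseteq> F"
    unfolding F_def using code_in_PiE assms rep by blast
  moreover have "finite F"
    unfolding F_def using fin by (intro finite_PiE) (auto simp: finite_imp_finite_nsets)
  ultimately have "card (higher_bruhat n k) \<le> card F"
    using card_inj_on_le by blast
  also have "card F = (\<Prod>(R, i)\<in>code_index n k. (n - max0 R - 1) choose (n - i))"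
    unfolding F_def using fin by (simp add: card_PiE card_nsets case_prod_unfold)
  also have "\<dots> = (\<Prod>R\<in>nsets {1..n} (k - 2). \<Prod>i\<in>{max0 R<..n}. (n - max0 R - 1) choose (n - i))"
    unfolding code_index_def by (rule prod.Sigma[symmetric]) (auto simp: finite_imp_finite_nsets)
  finally have "real (card (higher_bruhat n k)) \<le>
      (\<Prod>R\<in>nsets {1..n} (k - 2). \<Prod>i\<in>{max0 R<..n}. real ((n - max0 R - 1) choose (n - i)))"
    by (simp flip: of_nat_prod)
  also have "\<dots> \<le> (\<Prod>R\<in>nsets {1..n} (k - 2). exp (real ((n - max0 R) choose 2)))"
    by (intro prod_mono conjI prod_nonneg prod_binomial_interval_le_exp) auto
  also have "\<dots> = exp (real (\<Sum>R\<in>nsets {1..n} (k - 2). (n - max0 R) choose 2))"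
    by (simp add: exp_sum finite_imp_finite_nsets)
  also have "\<dots> \<le> exp (real (n choose k))"
    using sum_choose_2_le[OF assms] by (subst exp_le_cancel_iff, subst of_nat_le_iff)
  finally show ?thesis .
qed

lemma log_card_higher_bruhat_le:
  assumes "k \<ge> 2" "n \<ge> k"
  shows "log 2 (real (card (higher_bruhat n k))) \<le> real n ^ k / (fact k * ln 2)"
\<comment> \<open>The value 0 is covered by the convention \<open>ln 0 = 0\<close>.\<close>
proof (cases "card (higher_bruhat n k) = 0")
  case False
  have "ln (real (card (higher_bruhat n k))) \<le> ln (exp (real (n choose k)))"
    using card_higher_bruhat_le[OF assms(1), of n] False by (subst ln_le_cancel_iff) auto
  then have "ln (real (card (higher_bruhat n k))) \<le> real (n choose k)"
    by simp
  also have "\<dots> \<le> real n ^ k / fact k"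
  proof -
    have "fact k * (n choose k) \<le> n ^ k"
      using binomial_fact_pow[of n k] by (simp add: mult.commute)
    then have "real (fact k * (n choose k)) \<le> real (n ^ k)"
      by (simp only: of_nat_le_iff)
    then show ?thesis
      by (simp add: field_simps)
  qed
  finally show ?thesis
    by (simp add: log_def field_simps)
qed (simp add: log_def)

section \<open>Free choices on a level\<close>

text \<open>Removing \<open>x\<close> from \<open>X\<close> changes the sum of squares by
  \<open>-x^2\<close> and the square of the sum by \<open>x^2 - 2 x \<Sum>X\<close>. The squares
  cancel, and the total change \<open>2 x (c - \<Sum>X)\<close> is linear in \<open>x\<close>, with
  the sign of \<open>c - \<Sum>X\<close>.\<close>

definition potential :: "nat \<Rightarrow> nat set \<Rightarrow> int" where
  "potential c Z = (\<Sum>z\<in>Z. int z ^ 2) + (int (\<Sum>Z)) ^ 2 - 2 * int c * int (\<Sum>Z)"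

text \<open>If \<open>Z\<close> lies in the packet of a set \<open>X\<close> with sum \<open>c\<close>, the second component of the key
  encodes that \<open>X\<close>, so each such packet is consecutive. For other \<open>Z\<close> (for
  instance when the subtraction truncates) it is irrelevant; the last component makes the key injective.\<close>

definition order_key :: "nat \<Rightarrow> nat set set \<Rightarrow> nat set \<Rightarrow> int \<times> nat \<times> int \<times> nat" where
  "order_key c T Z = (- potential c Z, set_encode (insert (c - \<Sum>Z) Z),
     if insert (c - \<Sum>Z) Z \<in> T then - int (\<Sum>Z) else int (\<Sum>Z), set_encode Z)"

lemma potential_remove:
  assumes "finite X" "x \<in> X"
  shows "potential c (X - {x}) = potential c X + 2 * int x * (int c - int (\<Sum>X))"
proof -
  have 1: "int (\<Sum>(X - {x})) = int (\<Sum>X) - int x"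
    using assms by (simp add: sum_diff1)
  have 2: "(\<Sum>z\<in>X - {x}. int z ^ 2) = (\<Sum>z\<in>X. int z ^ 2) - int x ^ 2"
    using assms by (simp add: sum_diff1)
  show ?thesis
    unfolding potential_def 1 2 by algebra
qed

text \<open>Off the level the potential is strictly monotone in the removed element, so the first
  component of the key, its negative, already decides.\<close>

lemma order_key_off_level:
  assumes "finite X" "x \<in> X" "y \<in> X" "x < y"
  shows "\<Sum>X < c \<Longrightarrow> order_key c T (X - {y}) < order_key c T (X - {x})"
    and "\<Sum>X > c \<Longrightarrow> order_key c T (X - {x}) < order_key c T (X - {y})"
proof -
  have *: "potential c (X - {y}) - potential c (X - {x}) = 2 * (int y - int x) * (int c - int (\<Sum>X))"
    using potential_remove[OF assms(1,2), of c] potential_remove[OF assms(1,3), of c]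
    by (simp add: algebra_simps)
  show "order_key c T (X - {y}) < order_key c T (X - {x})" if "\<Sum>X < c"
  proof -
    have "potential c (X - {y}) - potential c (X - {x}) > 0"
      unfolding * using that assms(4) by (intro mult_pos_pos) (auto simp del: of_nat_sum)
    then show ?thesis
      by (simp add: order_key_def)
  qed
  show "order_key c T (X - {x}) < order_key c T (X - {y})" if "\<Sum>X > c"
  proof -
    have "potential c (X - {y}) - potential c (X - {x}) < 0"
      unfolding * using that assms(4) by (intro mult_pos_neg) (auto simp del: of_nat_sum)
    then show ?thesis
      by (simp add: order_key_def)
  qed
qed

text \<open>On the level \<open>c - \<Sum>(X - {z})\<close> is the removed element \<open>z\<close>,
  so the whole packet shares the first two components. The third is \<open>c - z\<close> up to a
  sign, and membership in \<open>T\<close> chooses the sign.\<close>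

lemma order_key_level:
  assumes "finite X" "x \<in> X" "y \<in> X" "x < y" "\<Sum>X = c"
  shows "order_key c T (X - {y}) < order_key c T (X - {x}) \<longleftrightarrow> X \<notin> T"
    and "order_key c T (X - {x}) < order_key c T (X - {y}) \<longleftrightarrow> X \<in> T"
proof -
  have sum: "\<Sum>(X - {z}) = c - z" "z \<le> c" if "z \<in> X" for z
    using assms(1,5) that member_le_sum[of z X "\<lambda>z. z"] by (simp_all add: sum_diff1_nat)
  then have ins: "insert (c - \<Sum>(X - {z})) (X - {z}) = X" if "z \<in> X" for z
    using that by (simp add: insert_absorb)
  have pot: "potential c (X - {z}) = potential c X" if "z \<in> X" for z
    using potential_remove[OF assms(1) that, of c] assms(5) by simp
  have key: "order_key c T (X - {z}) =
      (- potential c X, set_encode X, if X \<in> T then - int (c - z) else int (c - z), set_encode (X - {z}))"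
    if "z \<in> X" for z
    unfolding order_key_def ins[OF that] pot[OF that] by (simp only: sum(1)[OF that])
  have "int (c - y) < int (c - x)"
    using sum(2)[OF assms(3)] assms(4) by linarith
  then show "order_key c T (X - {y}) < order_key c T (X - {x}) \<longleftrightarrow> X \<notin> T"
    and "order_key c T (X - {x}) < order_key c T (X - {y}) \<longleftrightarrow> X \<in> T"
    unfolding key[OF assms(2)] key[OF assms(3)] by auto
qed

lemma ex_list_sorted_by_key:
  fixes key :: "'a \<Rightarrow> 'b :: linorder"
  assumes "finite A" "inj_on key A"
  obtains xs where "distinct xs" "set xs = A"
    "\<And>x y. \<lbrakk>x \<in> A; y \<in> A\<rbrakk> \<Longrightarrow> pos xs x < pos xs y \<longleftrightarrow> key x < key y"
proof -
  obtain ys where ys: "set ys = A" "distinct ys"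
    using finite_distinct_list[OF assms(1)] by blast
  define xs where "xs = sort_key key ys"
  have xs: "distinct xs" "set xs = A"
    using ys by (simp_all add: xs_def)
  have "sorted_wrt (\<lambda>x y. key x \<le> key y) (filter (\<lambda>_. True) xs)"
    using sorted_sort_key[of key ys] by (simp add: xs_def sorted_map)
  then have le: "key x \<le> key y" if "x \<in> A" "y \<in> A" "pos xs x < pos xs y" for x y
    using that xs unfolding sorted_wrt_filter_iff_pos[OF xs(1)] by blast
  have "pos xs x < pos xs y \<longleftrightarrow> key x < key y" if "x \<in> A" "y \<in> A" for x y
  proof
    assume "pos xs x < pos xs y"
    then have "key x \<le> key y" "x \<noteq> y"
      using le that by auto
    then show "key x < key y"
      using assms(2) that by (auto simp: inj_on_def order.order_iff_strict)
  next
    assume "key x < key y"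
    then have "\<not> pos xs y < pos xs x" "x \<noteq> y"
      using le that by force+
    then show "pos xs x < pos xs y"
      using pos_inj[of x xs y] xs(2) that by fastforce
  qed
  then show ?thesis
    using that xs by blast
qed

text \<open>Sorting by \<open>order_key\<close> orients a packet by the sign of
  \<open>\<Sum>X - c\<close> off the level and by \<open>T\<close> on it, so the order is admissible
  for every \<open>T\<close>.\<close>

lemma ex_order_with_prescribed_level:
  "\<exists>\<rho>\<in>admissible_orders n k. \<forall>X\<in>nsets {1..n} (k + 1). \<Sum>X = c \<longrightarrow>
     (X \<in> T \<longrightarrow> antilexed \<rho> X) \<and> (X \<notin> T \<longrightarrow> lexed \<rho> X)"
proof -
  have "inj_on (order_key c T) (nsets {1..n} k)"
    by (rule inj_onI) (auto simp: order_key_def nsets_def set_encode_eq)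
  then obtain \<rho> where \<rho>: "distinct \<rho>" "set \<rho> = nsets {1..n} k"
    "\<And>A B. \<lbrakk>A \<in> nsets {1..n} k; B \<in> nsets {1..n} k\<rbrakk> \<Longrightarrow>
      pos \<rho> A < pos \<rho> B \<longleftrightarrow> order_key c T A < order_key c T B"
    using ex_list_sorted_by_key[of "nsets {1..n} k" "order_key c T"]
    by (metis finite_atLeastAtMost finite_imp_finite_nsets)
  have pos: "pos \<rho> (X - {x}) < pos \<rho> (X - {y}) \<longleftrightarrow> order_key c T (X - {x}) < order_key c T (X - {y})"
    if "X \<in> nsets {1..n} (k + 1)" "x \<in> X" "y \<in> X" for X x y
    using that by (intro \<rho>(3)) (auto simp: nsets_def)
  have 1: "antilexed \<rho> X" if "X \<in> nsets {1..n} (k + 1)" "\<Sum>X = c" "X \<in> T" for X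
    unfolding antilexed_def using pos[OF that(1)] order_key_level(2)[of X _ _ c T] that
    by (auto simp: nsets_def)
  have 2: "lexed \<rho> X" if "X \<in> nsets {1..n} (k + 1)" "\<Sum>X = c" "X \<notin> T" for X
    unfolding lexed_def using pos[OF that(1)] order_key_level(1)[of X _ _ c T] that
    by (auto simp: nsets_def)
  have 3: "lexed \<rho> X" if "X \<in> nsets {1..n} (k + 1)" "\<Sum>X < c" for X
    unfolding lexed_def using pos[OF that(1)] order_key_off_level(1)[of X _ _ c T] that
    by (auto simp: nsets_def)
  have 4: "antilexed \<rho> X" if "X \<in> nsets {1..n} (k + 1)" "\<Sum>X > c" for X
    unfolding antilexed_def using pos[OF that(1)] order_key_off_level(2)[of X _ _ c T] that
    by (auto simp: nsets_def)
  have "\<rho> \<in> admissible_orders n k"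
    unfolding admissible_iff using \<rho>(1,2) 1 2 3 4 by (metis linorder_neqE_nat)
  then show ?thesis
    using 1 2 by blast
qed

section \<open>Separating commutation classes by orientations\<close>

lemma comm_equiv_antilexed:
  assumes "(\<rho>, \<sigma>) \<in> comm_equiv n k" "antilexed \<rho> X"
  shows "antilexed \<sigma> X"
  unfolding antilexed_def
proof (intro ballI impI)
  fix x y assume xy: "x \<in> X" "y \<in> X" "x < y"
  then have "\<not> commute (X - {x}) (X - {y})"
    by (subst not_commute_iff) auto
  then show "pos \<sigma> (X - {x}) < pos \<sigma> (X - {y})"
    using assms comm_steps_order xy unfolding comm_equiv_def antilexed_def by blast
qed

definition level :: "nat \<Rightarrow> nat \<Rightarrow> nat \<Rightarrow> nat set set" where
  "level n m c = {X \<in> nsets {1..n} m. \<Sum>X = c}"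

lemma finite_level: "finite (level n m c)"
  unfolding level_def by (simp add: finite_imp_finite_nsets)

text \<open>Each subset \<open>T\<close> of the level yields an order that is antilex on the level
  exactly for the members of \<open>T\<close>. Orientations are constant on classes, so
  \<open>T\<close> can be read off from the class.\<close>

lemma two_power_le_card_higher_bruhat:
  assumes "k \<ge> 1"
  shows "2 ^ card (level n (k + 1) c) \<le> card (higher_bruhat n k)"
proof -
  define M where "M = level n (k + 1) c"
  have "\<exists>\<rho>. \<rho> \<in> admissible_orders n k \<and> (\<forall>X\<in>M. (X \<in> T \<longrightarrow> antilexed \<rho> X) \<and> (X \<notin> T \<longrightarrow> lexed \<rho> X))" for T
    using ex_order_with_prescribed_level[of n k c T] by (auto simp: M_def level_def)
  then obtain r where r: "r T \<in> admissible_orders n k"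
    "\<And>X. X \<in> M \<Longrightarrow> X \<in> T \<Longrightarrow> antilexed (r T) X" "\<And>X. X \<in> M \<Longrightarrow> X \<notin> T \<Longrightarrow> lexed (r T) X" for T
    by metis
  \<comment> \<open>Lex and antilex exclude each other only on a packet with two members;
    \<open>k \<ge> 1\<close> provides them.\<close>
  have not_both: "\<not> (lexed \<rho> X \<and> antilexed \<rho> X)" if "X \<in> M" for X \<rho>
  proof -
    have "finite X" "card X \<ge> 2"
      using that assms by (auto simp: M_def level_def nsets_def)
    then obtain x y where "x \<in> X" "y \<in> X" "x < y"
      by (metis card_le_Suc0_iff_eq linorder_neqE_nat not_less_eq_eq numeral_2_eq_2)
    then show ?thesis
      unfolding lexed_def antilexed_def by (meson order.asym)
  qed
  have sub: "T \<subseteq> T'" if "T \<in> Pow M" "(r T, r T') \<in> comm_equiv n k" for T T'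
  proof
    fix X assume "X \<in> T"
    then have "X \<in> M" "antilexed (r T') X"
      using that r(2)[of X T] comm_equiv_antilexed by blast+
    then show "X \<in> T'"
      using r(3)[of X T'] not_both by blast
  qed
  have "inj_on (\<lambda>T. comm_equiv n k `` {r T}) (Pow M)"
  proof (rule inj_onI)
    fix T T' assume *: "T \<in> Pow M" "T' \<in> Pow M" "comm_equiv n k `` {r T} = comm_equiv n k `` {r T'}"
    then have "(r T, r T') \<in> comm_equiv n k"
      using eq_equiv_class[OF _ equiv_comm_equiv] r(1) by blast
    then have "(r T', r T) \<in> comm_equiv n k" "(r T, r T') \<in> comm_equiv n k"
      using equiv_comm_equiv[of n k] by (auto dest: equivE symD)
    then show "T = T'"
      using sub * by blast
  qed
  moreover have "(\<lambda>T. comm_equiv n k `` {r T}) ` Pow M \<subseteq> higher_bruhat n k"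
    using r(1) unfolding higher_bruhat_def by (auto intro: quotientI)
  ultimately have "card (Pow M) \<le> card (higher_bruhat n k)"
    using finite_higher_bruhat card_inj_on_le by blast
  then show ?thesis
    by (simp add: card_Pow M_def finite_level)
qed

section \<open>Counting sets with prescribed sum\<close>

definition level_lists :: "nat \<Rightarrow> nat \<Rightarrow> nat \<Rightarrow> nat list set" where
  "level_lists n m c = {xs. set xs \<subseteq> {1..n} \<and> length xs = m \<and> sum_list xs = c}"

lemma finite_level_lists: "finite (level_lists n m c)"
proof -
  have "level_lists n m c \<subseteq> {xs. set xs \<subseteq> {1..n} \<and> length xs = m}"
    by (auto simp: level_lists_def)
  then show ?thesis
    using finite_lists_length_eq finite_subset by blast
qed

text \<open>Two coordinates are redundant: entry \<open>b\<close> equals entry \<open>a\<close>, and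
  a third entry \<open>g\<close>, available since \<open>m \<ge> 3\<close>, is then fixed by the
  sum.\<close>

lemma card_level_lists_coincidence:
  assumes "a < m" "b < m" "a \<noteq> b" "m \<ge> 3"
  shows "card {xs \<in> level_lists n m c. xs ! a = xs ! b} \<le> n ^ (m - 2)"
proof -
  have "\<exists>g<m. g \<noteq> a \<and> g \<noteq> b"
  proof (rule ccontr)
    assume "\<not> ?thesis"
    then have "{..<m} \<subseteq> {a, b}"
      by auto
    then have "card {..<m} \<le> card {a, b}"
      by (intro card_mono) auto
    also have "\<dots> \<le> 2"
      by (simp add: card_insert_if)
    finally show False
      using assms(4) by simp
  qed
  then obtain g where g: "g < m" "g \<noteq> a" "g \<noteq> b"
    by blast
  define J where "J = {..<m} - {b, g}"
  define r where "r = (\<lambda>xs :: nat list. map ((!) xs) (sorted_list_of_set J))"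
  have J: "finite J" "card J = m - 2"
    using assms g by (auto simp: J_def card_Diff_subset)
  have "inj_on r {xs \<in> level_lists n m c. xs ! a = xs ! b}"
  proof (rule inj_onI, clarify)
    fix xs ys
    assume xs: "xs \<in> level_lists n m c" "xs ! a = xs ! b" and ys: "ys \<in> level_lists n m c" "ys ! a = ys ! b"
      and eq: "r xs = r ys"
    have len: "length xs = m" "length ys = m"
      using xs ys by (auto simp: level_lists_def)
    have J_eq: "xs ! i = ys ! i" if "i \<in> J" for i
      using eq that J(1) by (simp add: r_def)
    moreover have "a \<in> J"
      using assms g by (simp add: J_def)
    ultimately have b: "xs ! b = ys ! b"
      using xs(2) ys(2) by metis
    have "sum_list zs = zs ! g + (\<Sum>i\<in>{..<m} - {g}. zs ! i)" if "length zs = m" for zs :: "nat list"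
      using that g(1) by (simp add: sum_list_sum_nth atLeast0LessThan sum.remove)
    moreover have "(\<Sum>i\<in>{..<m} - {g}. xs ! i) = (\<Sum>i\<in>{..<m} - {g}. ys ! i)"
      using J_eq b by (intro sum.cong) (auto simp: J_def)
    moreover have "sum_list xs = sum_list ys"
      using xs ys by (simp add: level_lists_def)
    ultimately have "xs ! g = ys ! g"
      using len by simp
    then show "xs = ys"
      using J_eq b len by (intro nth_equalityI) (auto simp: J_def)
  qed
  moreover have "r ` {xs \<in> level_lists n m c. xs ! a = xs ! b} \<subseteq> {zs. set zs \<subseteq> {1..n} \<and> length zs = m - 2}"
  proof clarify
    fix xs assume xs: "xs \<in> level_lists n m c"
    have "xs ! i \<in> {1..n}" if "i \<in> J" for i
    proof -
      have "xs ! i \<in> set xs"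
        using that xs by (intro nth_mem) (simp add: level_lists_def J_def)
      then show ?thesis
        using xs by (auto simp: level_lists_def)
    qed
    then show "set (r xs) \<subseteq> {1..n} \<and> length (r xs) = m - 2"
      using J by (auto simp: r_def)
  qed
  ultimately have "card {xs \<in> level_lists n m c. xs ! a = xs ! b} \<le> card {zs. set zs \<subseteq> {1..n} \<and> length zs = m - 2}"
    by (intro card_inj_on_le) (auto intro: finite_lists_length_eq)
  then show ?thesis
    by (simp add: card_lists_length_eq)
qed

text \<open>A list without repetition is one of the \<open>m!\<close> orderings of a set in the
  level; any other list has one of at most \<open>m^2\<close> coincidences of two positions.\<close>

lemma card_level_lists_le:
  assumes "m \<ge> 3"
  shows "card (level_lists n m c) \<le> fact m * card (level n m c) + m ^ 2 * n ^ (m - 2)"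
proof -
  define I where "I = {(a, b). a < m \<and> b < m \<and> a \<noteq> b}"
  define bad where "bad = (\<lambda>(a, b). {xs \<in> level_lists n m c. xs ! a = xs ! b})"
  have I: "I \<subseteq> {..<m} \<times> {..<m}"
    by (auto simp: I_def)
  then have fin: "finite I"
    by (rule finite_subset) simp
  have "level_lists n m c \<subseteq> (\<Union>X\<in>level n m c. permutations_of_set X) \<union> (\<Union>e\<in>I. bad e)"
  proof
    fix xs assume xs: "xs \<in> level_lists n m c"
    show "xs \<in> (\<Union>X\<in>level n m c. permutations_of_set X) \<union> (\<Union>e\<in>I. bad e)"
    proof (cases "distinct xs")
      case True
      then have "set xs \<in> level n m c"
        using xs sum_list_distinct_conv_sum_set[of xs "\<lambda>x. x"]
        by (auto simp: level_def level_lists_def nsets_def distinct_card)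
      then show ?thesis
        using True by (auto simp: permutations_of_set_def)
    next
      case False
      then obtain a b where "a < m" "b < m" "a \<noteq> b" "xs ! a = xs ! b"
        using xs by (auto simp: distinct_conv_nth level_lists_def)
      then show ?thesis
        using xs by (auto simp: I_def bad_def)
    qed
  qed
  then have "card (level_lists n m c) \<le>
      card ((\<Union>X\<in>level n m c. permutations_of_set X) \<union> (\<Union>e\<in>I. bad e))"
    using fin finite_level_lists by (intro card_mono) (auto simp: finite_level bad_def)
  also have "\<dots> \<le> card (\<Union>X\<in>level n m c. permutations_of_set X) + card (\<Union>e\<in>I. bad e)"
    by (rule card_Un_le)
  also have "card (\<Union>X\<in>level n m c. permutations_of_set X) \<le> (\<Sum>X\<in>level n m c. card (permutations_of_set X))"
    by (rule card_UN_le[OF finite_level])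
  also have "\<dots> = fact m * card (level n m c)"
    by (simp add: level_def nsets_def card_permutations_of_set)
  also have "card (\<Union>e\<in>I. bad e) \<le> (\<Sum>e\<in>I. card (bad e))"
    by (rule card_UN_le[OF fin])
  also have "\<dots> \<le> (\<Sum>e\<in>I. n ^ (m - 2))"
    using assms by (intro sum_mono) (auto simp: I_def bad_def intro: card_level_lists_coincidence)
  also have "\<dots> \<le> m ^ 2 * n ^ (m - 2)"
    using card_mono[OF _ I] by (simp add: power2_eq_square card_cartesian_product)
  finally show ?thesis
    by simp
qed

section \<open>Cyclic gaps and Eulerian numbers\<close>

text \<open>The sentinels 0 and \<open>n\<close> sit at the indices 0 and \<open>k + 1\<close>,
  which a permutation of \<open>{1..k}\<close> fixes, so the permuted sequence still runs from 0 to
  \<open>n\<close>.\<close>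

definition bordered :: "nat \<Rightarrow> nat set \<Rightarrow> nat \<Rightarrow> nat" where
  "bordered n K i = (0 # sorted_list_of_set K @ [n]) ! i"

lemma bordered:
  assumes "K \<in> nsets {1..<n} k" "n > 0"
  shows "bordered n K 0 = 0" "bordered n K (Suc k) = n"
    and "\<lbrakk>i < j; j \<le> Suc k\<rbrakk> \<Longrightarrow> bordered n K i < bordered n K j"
    and "bordered n K ` {1..k} = K"
proof -
  have K: "finite K" "K \<subseteq> {1..<n}" "card K = k"
    using assms by (auto simp: nsets_def)
  then have len: "length (sorted_list_of_set K) = k"
    by simp
  show "bordered n K 0 = 0" "bordered n K (Suc k) = n"
    using len by (simp_all add: bordered_def nth_append)
  show "bordered n K i < bordered n K j" if "i < j" "j \<le> Suc k"
  proof -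
    have "sorted_wrt (<) (0 # sorted_list_of_set K @ [n])"
      using K assms(2) strict_sorted_list_of_set[of K] by (auto simp: sorted_wrt_append)
    then show ?thesis
      unfolding bordered_def using that len by (elim sorted_wrt_nth_less) simp_all
  qed
  have "bordered n K ` {1..k} = (\<lambda>i. sorted_list_of_set K ! i) ` {..<k}"
  proof -
    have "{1..k} = Suc ` {..<k}"
      by (simp add: lessThan_atLeast0 image_Suc_atLeastLessThan atLeastLessThanSuc_atLeastAtMost)
    then show ?thesis
      using len by (auto simp: bordered_def nth_append image_image)
  qed
  also have "\<dots> = K"
    using K(1) len nth_image[of k "sorted_list_of_set K"] by (simp add: lessThan_atLeast0)
  finally show "bordered n K ` {1..k} = K" .
qed

definition cyclic_gaps :: "nat \<Rightarrow> nat \<Rightarrow> nat set \<times> (nat \<Rightarrow> nat) \<Rightarrow> nat list" where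
  "cyclic_gaps n k = (\<lambda>(K, p). map (\<lambda>i.
     bordered n K (p (Suc i)) + (if p (Suc i) < p i then n else 0) - bordered n K (p i)) [0..<Suc k])"

text \<open>The natural subtraction never truncates: the sequence increases at an ascent, and at a
  descent \<open>n\<close> is added while all entries are at most \<open>n\<close>.\<close>

lemma cyclic_gaps_nth:
  assumes "K \<in> nsets {1..<n} k" "n > 0" "k \<ge> 1" "p permutes {1..k}" "i \<le> k"
  defines "y \<equiv> \<lambda>i. bordered n K (p i)"
  shows "cyclic_gaps n k (K, p) ! i + y i = y (Suc i) + (if p (Suc i) < p i then n else 0)"
    and "cyclic_gaps n k (K, p) ! i \<in> {1..n}"
proof -
  note b = bordered[OF assms(1,2)]
  have le: "p j \<le> Suc k" if "j \<le> Suc k" for j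
    using permutes_in_image[OF assms(4), of j] permutes_not_in[OF assms(4), of j] that
    by (cases "j \<in> {1..k}") auto
  have y_le: "y j \<le> n" if "j \<le> Suc k" for j
    using b(2) b(3)[of "p j" "Suc k"] le[OF that] unfolding y_def by (cases "p j = Suc k") auto
  have y_pos: "y (Suc i) > 0"
  proof -
    have "p (Suc i) \<noteq> 0"
      using permutes_in_image[OF assms(4), of "Suc i"] permutes_not_in[OF assms(4), of "Suc i"]
      by (cases "Suc i \<in> {1..k}") auto
    then show ?thesis
      using b(1) b(3)[of 0 "p (Suc i)"] le[of "Suc i"] assms(5) unfolding y_def by simp
  qed
  have ne: "p (Suc i) \<noteq> p i"
    by (simp add: inj_eq[OF permutes_inj[OF assms(4)]])
  have *: "cyclic_gaps n k (K, p) ! i = y (Suc i) + (if p (Suc i) < p i then n else 0) - y i"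
    unfolding cyclic_gaps_def y_def using assms(5) by (simp del: upt_Suc)
  have less: "y i < y (Suc i)" if "p i < p (Suc i)"
    using b(3)[OF that] le[of "Suc i"] assms(5) by (simp add: y_def)
  have greater: "y (Suc i) < y i" if "p (Suc i) < p i"
    using b(3)[OF that] le[of i] assms(5) by (simp add: y_def)
  show "cyclic_gaps n k (K, p) ! i + y i = y (Suc i) + (if p (Suc i) < p i then n else 0)"
  proof (cases "p (Suc i) < p i")
    case True
    then show ?thesis
      using * y_le[of i] assms(5) by simp
  next
    case False
    then have "y i < y (Suc i)"
      using less ne by simp
    then show ?thesis
      using * False by simp
  qed
  show "cyclic_gaps n k (K, p) ! i \<in> {1..n}"
  proof (cases "p (Suc i) < p i")
    case True
    then show ?thesis
      using * y_le[of i] y_pos greater[OF True] assms(5) by simp linarith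
  next
    case False
    then have "y i < y (Suc i)"
      using less ne by simp
    then show ?thesis
      using * False y_le[of "Suc i"] assms(5) by simp linarith
  qed
qed

text \<open>The differences telescope to \<open>n - 0\<close>, and each of the \<open>d\<close>
  descents contributes a further \<open>n\<close>.\<close>

lemma cyclic_gaps_mem_level_lists:
  assumes "K \<in> nsets {1..<n} k" "n > 0" "k \<ge> 1" "p permutes {1..k}"
    and "card {i \<in> {1..<k}. p i > p (i + 1)} = d"
  shows "cyclic_gaps n k (K, p) \<in> level_lists n (Suc k) (n * Suc d)"
proof -
  let ?xs = "cyclic_gaps n k (K, p)"
  define y where "y = (\<lambda>i. bordered n K (p i))"
  note gap = cyclic_gaps_nth[OF assms(1-4)]
  have len: "length ?xs = Suc k"
    by (simp add: cyclic_gaps_def)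
  then have "set ?xs \<subseteq> {1..n}"
    using gap(2) by (auto simp: in_set_conv_nth less_Suc_eq_le)
  have p0: "p 0 = 0" "p (Suc k) = Suc k"
    using permutes_not_in[OF assms(4)] by auto
  \<comment> \<open>The first step leaves 0 and the last one reaches \<open>k + 1\<close>; both are
    ascents, so only the descents of \<open>p\<close> itself count.\<close>
  have desc: "{i \<in> {..<Suc k}. p (Suc i) < p i} = {i \<in> {1..<k}. p i > p (i + 1)}"
  proof -
    have "p k < p (Suc k)"
      using permutes_in_image[OF assms(4), of k] p0 assms(3) by auto
    then have "i \<noteq> k" "i \<noteq> 0" if "p (Suc i) < p i" for i
      using that p0 by (auto dest: order.asym)
    then show ?thesis
      by (fastforce simp: less_Suc_eq Suc_le_eq)
  qed
  have "int (sum_list ?xs) = (\<Sum>i<Suc k. int (?xs ! i))"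
    by (simp only: sum_list_sum_nth len atLeast0LessThan of_nat_sum)
  also have "\<dots> = (\<Sum>i<Suc k. (int (y (Suc i)) - int (y i)) + int n * of_bool (p (Suc i) < p i))"
  proof (intro sum.cong refl)
    fix i assume "i \<in> {..<Suc k}"
    then have "int (?xs ! i + y i) = int (y (Suc i) + (if p (Suc i) < p i then n else 0))"
      using gap(1)[of i] by (simp only: y_def less_Suc_eq_le lessThan_iff)
    then show "int (?xs ! i) = (int (y (Suc i)) - int (y i)) + int n * of_bool (p (Suc i) < p i)"
      by (auto split: if_splits)
  qed
  also have "\<dots> = int (y (Suc k)) - int (y 0) + int n * (\<Sum>i<Suc k. of_bool (p (Suc i) < p i))"
    by (simp only: sum.distrib sum_lessThan_telescope[of "\<lambda>i. int (y i)"] sum_distrib_left)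
  also have "(\<Sum>i<Suc k. of_bool (p (Suc i) < p i)) = int d"
  proof -
    have "{..<Suc k} \<inter> {i. p (Suc i) < p i} = {i \<in> {..<Suc k}. p (Suc i) < p i}"
      by blast
    then have "card ({..<Suc k} \<inter> {i. p (Suc i) < p i}) = d"
      using desc assms(5) by (simp only:)
    then show ?thesis
      by (simp only: sum_of_bool_eq finite_lessThan)
  qed
  also have "int (y (Suc k)) - int (y 0) + int n * int d = int (n * Suc d)"
    using p0 bordered(1,2)[OF assms(1,2)] by (simp add: y_def)
  finally have "sum_list ?xs = n * Suc d"
    by (simp only: of_nat_eq_iff)
  then show ?thesis
    using len \<open>set ?xs \<subseteq> _\<close> by (simp add: level_lists_def)
qed

text \<open>The elements of \<open>K\<close> lie below \<open>n\<close>, so starting from 0 each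
  entry is determined modulo \<open>n\<close> by its predecessor and the gap. The entries form the
  set \<open>K\<close>, and their places in its increasing order give \<open>p\<close>.\<close>

lemma inj_on_cyclic_gaps:
  assumes "n > 0" "k \<ge> 1"
  shows "inj_on (cyclic_gaps n k) (nsets {1..<n} k \<times> {p. p permutes {1..k}})"
proof (rule inj_onI, clarify)
  fix K p K' p'
  assume K: "K \<in> nsets {1..<n} k" "K' \<in> nsets {1..<n} k" and p: "p permutes {1..k}" "p' permutes {1..k}"
    and eq: "cyclic_gaps n k (K, p) = cyclic_gaps n k (K', p')"
  have step: "bordered n L (q (Suc i)) = (bordered n L (q i) + cyclic_gaps n k (L, q) ! i) mod n"
    if "L \<in> nsets {1..<n} k" "q permutes {1..k}" "i < k" for L q i
  proof -
    have "q (Suc i) \<in> {1..k}"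
      using permutes_in_image[OF that(2), of "Suc i"] that(3) by simp
    then have "bordered n L (q (Suc i)) \<in> L"
      using bordered(4)[OF that(1) assms(1)] by blast
    then have "bordered n L (q (Suc i)) < n"
      using that(1) by (auto simp: nsets_def)
    then show ?thesis
      using cyclic_gaps_nth(1)[OF that(1) assms that(2), of i] that(3)
      by (simp add: add.commute split: if_splits)
  qed
  have y: "bordered n K (p i) = bordered n K' (p' i)" if "i \<le> k" for i
    using that
  proof (induction i)
    case 0
    then show ?case
      using permutes_not_in[OF p(1), of 0] permutes_not_in[OF p(2), of 0] bordered(1) K assms(1) by simp
  next
    case (Suc i)
    then show ?case
      using step[OF K(1) p(1), of i] step[OF K(2) p(2), of i] eq by simp
  qed
  have range: "(\<lambda>i. bordered n L (q i)) ` {1..k} = L"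
    if "L \<in> nsets {1..<n} k" "q permutes {1..k}" for L q
    using bordered(4)[OF that(1) assms(1)] permutes_image[OF that(2)] by (metis image_image)
  have "(\<lambda>i. bordered n K (p i)) ` {1..k} = (\<lambda>i. bordered n K' (p' i)) ` {1..k}"
    using y by (intro image_cong) auto
  then have KK: "K = K'"
    using range[OF K(1) p(1)] range[OF K(2) p(2)] by simp
  moreover have "p = p'"
  proof
    fix i
    show "p i = p' i"
    proof (cases "i \<in> {1..k}")
      case True
      then have "p i \<le> k" "p' i \<le> k"
        using permutes_in_image[OF p(1), of i] permutes_in_image[OF p(2), of i] by auto
      moreover have "bordered n K (p i) = bordered n K (p' i)"
        using y[of i] True KK by simp
      ultimately show ?thesis
        using bordered(3)[OF K(1) assms(1), of "p i" "p' i"] bordered(3)[OF K(1) assms(1), of "p' i" "p i"]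
        by (metis le_SucI less_irrefl linorder_neqE_nat)
    next
      case False
      then show ?thesis
        using permutes_not_in p by metis
    qed
  qed
  ultimately show "K = K' \<and> p = p'" ..
qed

lemma eulerian_le_card_level_lists:
  assumes "n > 0" "k \<ge> 1"
  shows "((n - 1) choose k) * eulerian k d \<le> card (level_lists n (Suc k) (n * Suc d))"
proof -
  define P where "P = {p. p permutes {1..k} \<and> card {i \<in> {1..<k}. p i > p (i + 1)} = d}"
  have "inj_on (cyclic_gaps n k) (nsets {1..<n} k \<times> P)"
    by (rule inj_on_subset[OF inj_on_cyclic_gaps[OF assms]]) (auto simp: P_def)
  moreover have "cyclic_gaps n k ` (nsets {1..<n} k \<times> P) \<subseteq> level_lists n (Suc k) (n * Suc d)"
    using cyclic_gaps_mem_level_lists[OF _ assms] unfolding P_def by blast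
  ultimately have "card (nsets {1..<n} k \<times> P) \<le> card (level_lists n (Suc k) (n * Suc d))"
    using finite_level_lists card_inj_on_le by blast
  then show ?thesis
    by (simp add: card_cartesian_product card_nsets eulerian_def P_def)
qed

section \<open>Asymptotic estimates\<close>

text \<open>Each of the \<open>k\<close> factors of the falling factorial is at least
  \<open>n - k\<close>, and Bernoulli's inequality bounds \<open>(1 - k / n) ^ k\<close> below by
  \<open>1 - k^2 / n\<close>.\<close>

lemma binomial_pred_ge:
  assumes "n > k"
  shows "real n ^ k - real k ^ 2 * real n ^ (k - 1) \<le> fact k * real ((n - 1) choose k)"
proof (cases "k = 0")
  case False
  have "real n ^ k - real k ^ 2 * real n ^ (k - 1) = real n ^ k * (1 + real k * (- (real k / real n)))"
    using assms False by (simp add: power_eq_if power2_eq_square field_simps)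
  also have "\<dots> \<le> real n ^ k * (1 + - (real k / real n)) ^ k"
    using assms by (intro mult_left_mono Bernoulli_inequality) (auto simp: field_simps)
  also have "\<dots> = (\<Prod>i = 0..<k. real n - real k)"
    using assms by (simp add: power_mult_distrib[symmetric] field_simps)
  also have "\<dots> \<le> (\<Prod>i = 0..<k. real (n - 1) - real i)"
    using assms by (intro prod_mono) auto
  also have "\<dots> = fact k * real ((n - 1) choose k)"
    by (simp add: binomial_gbinomial gbinomial_prod_rev)
  finally show ?thesis .
qed simp

text \<open>Of the two error terms, the one with the Eulerian number comes from replacing the
  binomial coefficient by \<open>n ^ k / k!\<close>, the other from the lists with a repeated
  entry.\<close>

lemma card_level_ge:
  assumes "n > k" "k \<ge> 2"
  shows "real (eulerian k d) * real n ^ k / (fact k * fact (k + 1)) -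
      (real (eulerian k d) * real k ^ 2 / fact k + real (k + 1) ^ 2) / fact (k + 1) * real n ^ (k - 1)
    \<le> real (card (level n (k + 1) (n * Suc d)))"
proof -
  let ?A = "real (eulerian k d)"
  have "((n - 1) choose k) * eulerian k d \<le>
      fact (k + 1) * card (level n (k + 1) (n * Suc d)) + (k + 1) ^ 2 * n ^ (k - 1)"
    using eulerian_le_card_level_lists[of n k d] card_level_lists_le[of "k + 1" n "n * Suc d"] assms
    by simp
  then have "real (((n - 1) choose k) * eulerian k d) \<le>
      real (fact (k + 1) * card (level n (k + 1) (n * Suc d)) + (k + 1) ^ 2 * n ^ (k - 1))"
    by (simp only: of_nat_le_iff)
  then have 1: "real ((n - 1) choose k) * ?A \<le>
      fact (k + 1) * real (card (level n (k + 1) (n * Suc d))) + real (k + 1) ^ 2 * real n ^ (k - 1)"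
    by (simp only: of_nat_add of_nat_mult of_nat_power of_nat_fact)
  have "(real n ^ k - real k ^ 2 * real n ^ (k - 1)) / fact k \<le> real ((n - 1) choose k)"
    using binomial_pred_ge[OF assms(1)] by (simp add: field_simps)
  then have "(real n ^ k - real k ^ 2 * real n ^ (k - 1)) / fact k * ?A \<le> real ((n - 1) choose k) * ?A"
    by (intro mult_right_mono) auto
  then have "((real n ^ k - real k ^ 2 * real n ^ (k - 1)) / fact k * ?A - real (k + 1) ^ 2 * real n ^ (k - 1)) / fact (k + 1)
      \<le> real (card (level n (k + 1) (n * Suc d)))"
    using 1 by (subst pos_divide_le_eq) (auto simp: mult.commute)
  moreover have "?A * real n ^ k / (fact k * fact (k + 1)) -
      (?A * real k ^ 2 / fact k + real (k + 1) ^ 2) / fact (k + 1) * real n ^ (k - 1) =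
      ((real n ^ k - real k ^ 2 * real n ^ (k - 1)) / fact k * ?A - real (k + 1) ^ 2 * real n ^ (k - 1)) / fact (k + 1)"
    by (simp add: diff_divide_distrib add_divide_distrib left_diff_distrib right_diff_distrib
        distrib_left distrib_right mult.commute mult.left_commute del: fact_Suc)
  ultimately show ?thesis
    by linarith
qed

lemma log_card_higher_bruhat_ge:
  assumes "k \<ge> 1"
  shows "real (card (level n (k + 1) c)) \<le> log 2 (real (card (higher_bruhat n k)))"
  by (rule le_log2_of_power[OF two_power_le_card_higher_bruhat[OF assms]])

theorem theorem44:
  fixes k :: nat
  assumes "k \<ge> 2"
  shows "\<exists>f g :: nat \<Rightarrow> real.
    f \<in> O(\<lambda>n. real n ^ (k - 1)) \<and>
    g \<in> O(\<lambda>n. real n ^ (k - 1) * ln (real n)) \<and>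
    (\<forall>\<^sub>F n in sequentially.
       real (eulerian k ((k - 1) div 2)) * real n ^ k / (fact k * fact (k + 1)) + f n
         \<le> log 2 (real (card (higher_bruhat n k))) \<and>
       log 2 (real (card (higher_bruhat n k)))
         \<le> real n ^ k / (fact k * ln 2) + g n)"
proof -
  \<comment> \<open>The lower estimate holds for every \<open>d\<close>; this one is the central
    index, where the Eulerian numbers peak.\<close>
  define d where "d = (k - 1) div 2"
  define C :: real where
    "C = (real (eulerian k d) * real k ^ 2 / fact k + real (k + 1) ^ 2) / fact (k + 1)"
  have "real (eulerian k d) * real n ^ k / (fact k * fact (k + 1)) + - C * real n ^ (k - 1)
      \<le> log 2 (real (card (higher_bruhat n k)))" if "n > k" for n
  proof -
    have "real (eulerian k d) * real n ^ k / (fact k * fact (k + 1)) - C * real n ^ (k - 1)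
        \<le> real (card (level n (k + 1) (n * Suc d)))"
      unfolding C_def by (rule card_level_ge[OF that assms])
    also have "\<dots> \<le> log 2 (real (card (higher_bruhat n k)))"
      using assms by (intro log_card_higher_bruhat_ge) simp
    finally show ?thesis
      by simp
  qed
  moreover have "(\<lambda>n. - C * real n ^ (k - 1)) \<in> O(\<lambda>n. real n ^ (k - 1))"
    by (rule bigoI[of _ "\<bar>C\<bar>"]) (simp add: abs_mult)
  moreover have "(\<lambda>n. 0) \<in> O(\<lambda>n. real n ^ (k - 1) * ln (real n))"
    by simp
  ultimately show ?thesis
    \<comment> \<open>The upper bound holds with error term 0, so \<open>g\<close> is the zero
      function.\<close>
    unfolding d_def using log_card_higher_bruhat_le[OF assms]
    by (intro exI[of _ "\<lambda>n. - C * real n ^ (k - 1)"] exI[of _ "\<lambda>n. 0"] conjI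
          eventually_sequentiallyI[of "Suc k"]) auto
qed

end
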